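(* There is an algorithm that solves Balanced Vertex in ${\cal O}(n)$ time on instances $(G,\pi,S)$ where $G$ is a path with $n$ vertices.
   Context: All graphs are finite, simple, connected, with unit-length edges; $d(u,v)$ is the shortest-path distance. A proper vertex list is a list $S=(s_1,\ldots,s_p)$ of pairwise different vertices; $d(v,S)=\min_i d(v,s_i)$. The (prioritized) Voronoi diagram of $G=(V,E)$ with respect to $S$ is the partition of $V$ into territories $\mathbb{T}(s_1,S),\ldots,\mathbb{T}(s_p,S)$ where $v\in\mathbb{T}(s_i,S)$ if and only if $d(v,s_i)=d(v,S)$ and $d(v,s_j)>d(v,S)$ for every $j$ with $1\le j<i$. For a cost function $\pi:V\to\mathbb{R}_{\ge 0}$, the load of $s_i$ is $\ell_\pi(s_i,S)=\sum_{v\in\mathbb{T}(s_i,S)}\pi(v)$, and $L_\pi(S)=\max_i \ell_\pi(s_i,S)$. For $v\in V\setminus S$, $S+v=(s_1,\ldots,s_p,v)$. Balanced Vertex: given a graph $G=(V,E)$, a cost function $\pi:V\to\mathbb{R}_{\ge 0}$ and a proper vertex list $S$, output a vertex $v\in V\setminus S$ such that $L_\pi(S+v)$ is minimized. Running times are worst-case, in the usual unit-cost RAM model. *)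

theory Defs
  imports Complex_Main "HOL-Library.Landau_Symbols"
begin

section \<open>Graphs\<close>

definition simple_graph :: "'a set \<Rightarrow> 'a set set \<Rightarrow> bool" where
  "simple_graph V E \<longleftrightarrow> finite V \<and> (\<forall>e\<in>E. e \<subseteq> V \<and> card e = 2)"

definition walk_betw :: "'a set \<Rightarrow> 'a set set \<Rightarrow> 'a \<Rightarrow> 'a list \<Rightarrow> 'a \<Rightarrow> bool" where
  "walk_betw V E u w v \<longleftrightarrow>
     w \<noteq> [] \<and> set w \<subseteq> V \<and> successively (\<lambda>x y. {x, y} \<in> E) w \<and> hd w = u \<and> last w = v"

definition connected_graph :: "'a set \<Rightarrow> 'a set set \<Rightarrow> bool" where
  "connected_graph V E \<longleftrightarrow> (\<forall>u\<in>V. \<forall>v\<in>V. \<exists>w. walk_betw V E u w v)"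

definition graph_dist :: "'a set \<Rightarrow> 'a set set \<Rightarrow> 'a \<Rightarrow> 'a \<Rightarrow> nat" where
  "graph_dist V E u v = (LEAST k. \<exists>w. walk_betw V E u w v \<and> length w = Suc k)"

text \<open>A single vertex without edges is a path.\<close>

definition is_path :: "'a set \<Rightarrow> 'a set set \<Rightarrow> bool" where
  "is_path V E \<longleftrightarrow>
     (\<exists>vs. vs \<noteq> [] \<and> distinct vs \<and> set vs = V \<and>
           E = {{vs ! i, vs ! Suc i} | i. Suc i < length vs})"


section \<open>Prioritized Voronoi diagrams and Balanced Vertex\<close>

text \<open>
  List positions are counted from 0, and territories and loads are indexed by the
  position \<open>i\<close> rather than by the vertex \<open>S ! i\<close>; proper vertex lists have no repetitions.
\<close>

definition proper_list :: "'a set \<Rightarrow> 'a list \<Rightarrow> bool" where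
  "proper_list V S \<longleftrightarrow> distinct S \<and> set S \<subseteq> V"

definition dist_list :: "'a set \<Rightarrow> 'a set set \<Rightarrow> 'a \<Rightarrow> 'a list \<Rightarrow> nat" where
  "dist_list V E v S = Min (graph_dist V E v ` set S)"

definition territory :: "'a set \<Rightarrow> 'a set set \<Rightarrow> 'a list \<Rightarrow> nat \<Rightarrow> 'a set" where
  "territory V E S i =
     {v \<in> V. graph_dist V E v (S ! i) = dist_list V E v S \<and>
             (\<forall>j<i. graph_dist V E v (S ! j) > dist_list V E v S)}"

definition load :: "'a set \<Rightarrow> 'a set set \<Rightarrow> ('a \<Rightarrow> real) \<Rightarrow> 'a list \<Rightarrow> nat \<Rightarrow> real" where
  "load V E \<pi> S i = (\<Sum>v\<in>territory V E S i. \<pi> v)"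

definition max_load :: "'a set \<Rightarrow> 'a set set \<Rightarrow> ('a \<Rightarrow> real) \<Rightarrow> 'a list \<Rightarrow> real" where
  "max_load V E \<pi> S = Max (load V E \<pi> S ` {..<length S})"

text \<open>
  An instance must leave at least one vertex outside \<open>S\<close>, since otherwise there is nothing
  to output.  The empty list is admitted: only the lists \<open>S @ [v]\<close> are ever evaluated.
\<close>

definition balanced_vertex_instance ::
    "'a set \<Rightarrow> 'a set set \<Rightarrow> ('a \<Rightarrow> real) \<Rightarrow> 'a list \<Rightarrow> bool" where
  "balanced_vertex_instance V E \<pi> S \<longleftrightarrow>
     simple_graph V E \<and> connected_graph V E \<and> (\<forall>v\<in>V. \<pi> v \<ge> 0) \<and>
     proper_list V S \<and> V - set S \<noteq> {}"

definition balanced_vertex ::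
    "'a set \<Rightarrow> 'a set set \<Rightarrow> ('a \<Rightarrow> real) \<Rightarrow> 'a list \<Rightarrow> 'a \<Rightarrow> bool" where
  "balanced_vertex V E \<pi> S = is_arg_min (\<lambda>v. max_load V E \<pi> (S @ [v])) (\<lambda>v. v \<in> V - set S)"


section \<open>Unit-cost random access machine\<close>

text \<open>
  A RAM whose cells hold natural numbers, extended by cells holding real numbers, because
  vertex costs are arbitrary nonnegative reals.  A program mentions only finitely many
  registers; the two memories are reached by indirect addressing.  Every instruction costs one
  step.  The instruction set is deliberately small:
  there is no multiplication or division, the only real constant available is 0, and reals
  cannot be converted to naturals or back.
\<close>

datatype instr =
    Const nat nat
  | Add nat nat nat
  | Sub nat nat nat
  | Load nat nat
  | Store nat nat
  | RAdd nat nat nat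
  | RSub nat nat nat
  | RLoad nat nat
  | RStore nat nat
  | Jump nat
  | JumpLess nat nat nat
  | RJumpLess nat nat nat

record ram =
  pc :: nat
  nreg :: "nat \<Rightarrow> nat"
  rreg :: "nat \<Rightarrow> real"
  nmem :: "nat \<Rightarrow> nat"
  rmem :: "nat \<Rightarrow> real"

abbreviation incr_pc :: "ram \<Rightarrow> ram" where
  "incr_pc s \<equiv> s\<lparr>pc := Suc (pc s)\<rparr>"

text \<open>Subtraction on natural numbers is truncated at 0.\<close>

fun exec_instr :: "instr \<Rightarrow> ram \<Rightarrow> ram" where
  "exec_instr (Const i c) s = incr_pc (s\<lparr>nreg := (nreg s)(i := c)\<rparr>)"
| "exec_instr (Add i j k) s = incr_pc (s\<lparr>nreg := (nreg s)(i := nreg s j + nreg s k)\<rparr>)"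
| "exec_instr (Sub i j k) s = incr_pc (s\<lparr>nreg := (nreg s)(i := nreg s j - nreg s k)\<rparr>)"
| "exec_instr (Load i j) s = incr_pc (s\<lparr>nreg := (nreg s)(i := nmem s (nreg s j))\<rparr>)"
| "exec_instr (Store i j) s = incr_pc (s\<lparr>nmem := (nmem s)(nreg s i := nreg s j)\<rparr>)"
| "exec_instr (RAdd i j k) s = incr_pc (s\<lparr>rreg := (rreg s)(i := rreg s j + rreg s k)\<rparr>)"
| "exec_instr (RSub i j k) s = incr_pc (s\<lparr>rreg := (rreg s)(i := rreg s j - rreg s k)\<rparr>)"
| "exec_instr (RLoad i j) s = incr_pc (s\<lparr>rreg := (rreg s)(i := rmem s (nreg s j))\<rparr>)"
| "exec_instr (RStore i j) s = incr_pc (s\<lparr>rmem := (rmem s)(nreg s i := rreg s j)\<rparr>)"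
| "exec_instr (Jump l) s = s\<lparr>pc := l\<rparr>"
| "exec_instr (JumpLess i j l) s =
     (if nreg s i < nreg s j then s\<lparr>pc := l\<rparr> else incr_pc s)"
| "exec_instr (RJumpLess i j l) s =
     (if rreg s i < rreg s j then s\<lparr>pc := l\<rparr> else incr_pc s)"

text \<open>A machine halts as soon as the program counter points outside the program.\<close>

definition halted :: "instr list \<Rightarrow> ram \<Rightarrow> bool" where
  "halted P s \<longleftrightarrow> length P \<le> pc s"

definition step :: "instr list \<Rightarrow> ram \<Rightarrow> ram" where
  "step P s = (if halted P s then s else exec_instr (P ! pc s) s)"

definition halts_within :: "instr list \<Rightarrow> ram \<Rightarrow> nat \<Rightarrow> ram \<Rightarrow> bool" where
  "halts_within P s t s' \<longleftrightarrow> (\<exists>k\<le>t. (step P ^^ k) s = s' \<and> halted P s')"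


section \<open>Input and output\<close>

text \<open>
  Graphs with vertex set \<open>{..<n}\<close> are given by adjacency lists, in which the neighbours may
  appear in any order.
\<close>

definition adjacency_lists :: "nat \<Rightarrow> nat set set \<Rightarrow> nat list list \<Rightarrow> bool" where
  "adjacency_lists n E adj \<longleftrightarrow>
     length adj = n \<and> (\<forall>v<n. distinct (adj ! v) \<and> set (adj ! v) = {u. {u, v} \<in> E})"

text \<open>
  In the memory the adjacency lists are stored contiguously, preceded by a table of \<open>n + 1\<close>
  offsets: the neighbours of \<open>v\<close> are the entries of \<open>concat adj\<close> from offset number \<open>v\<close>
  up to, but excluding, offset number \<open>v + 1\<close>.
\<close>

definition input_words :: "nat \<Rightarrow> nat list list \<Rightarrow> nat list \<Rightarrow> nat list" where
  "input_words n adj S =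
     [n, length S] @ S @ map (\<lambda>v. length (concat (take v adj))) [0..<Suc n] @ concat adj"

definition input_state :: "nat \<Rightarrow> nat list list \<Rightarrow> (nat \<Rightarrow> real) \<Rightarrow> nat list \<Rightarrow> ram" where
  "input_state n adj \<pi> S =
     \<lparr>pc = 0, nreg = (\<lambda>_. 0), rreg = (\<lambda>_. 0),
      nmem = (\<lambda>a. if a < length (input_words n adj S) then input_words n adj S ! a else 0),
      rmem = (\<lambda>a. if a < n then \<pi> a else 0)\<rparr>"

definition output_vertex :: "ram \<Rightarrow> nat" where
  "output_vertex s = nreg s 0"

end

theory Submission
  imports Defs
begin

text \<open>
  On a path, two consecutive sources \<open>a < b\<close> divide the positions \<open>x\<close> between them according
  to whether \<open>2 * x\<close> lies below a border (\<open>a + b\<close>, or \<open>a + b + 1\<close> if \<open>a\<close> has the higher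
  priority), so with prefix sums of the costs indexed by \<open>2 * x\<close> every load is a difference of
  two table entries, and no halving is needed.  A new source \<open>k\<close> only changes the loads of the
  sources \<open>a\<close>, \<open>b\<close> next to it.  A sweep from the right tabulates \<open>b\<close>, the right border
  of its territory and the maximal load beyond \<open>b\<close>; a sweep from the left maintains the same
  data for \<open>a\<close> and evaluates all candidates in constant time each.  Two sentinel sources, so far
  outside the path that they never own one of its vertices, make \<open>a\<close> and \<open>b\<close> always exist.
\<close>

section \<open>Structured programs for the machine\<close>

text \<open>Positions are not part of the input: the vertices are numbered arbitrarily, so the order
  along the path has to be recovered from the adjacency lists, starting at an endpoint. The endpoint
  found is the least vertex of degree below 2. Since a reversed path is again a path, the
  orientation that begins there may be assumed.

  The candidate comes last in \<open>S @ [v]\<close> and loses every tie, so its borders are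
  \<open>a + k + 1\<close> and \<open>k + b\<close> whatever the marks of \<open>a\<close> and
  \<open>b\<close>. The load of an old source is known only once both of its borders are; a sweep
  therefore carries one source with an open border and lets its load enter the running maximum when
  the next source is met.

  For the running time, all loop bodies are loop-free, so a body is a total function on states that
  takes at most as many steps as it has instructions. The number of rounds of every loop is fixed by
  the input: it is \<open>p\<close>, \<open>vs ! 0\<close>, \<open>n\<close> or
  \<open>3 * n\<close>. Linear time is then a matter of adding up.\<close>

datatype test = NLess nat nat | RLess nat nat

fun holds :: "test \<Rightarrow> ram \<Rightarrow> bool" where
  "holds (NLess i j) s \<longleftrightarrow> nreg s i < nreg s j"
| "holds (RLess i j) s \<longleftrightarrow> rreg s i < rreg s j"

fun jump_if :: "test \<Rightarrow> nat \<Rightarrow> instr" where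
  "jump_if (NLess i j) l = JumpLess i j l"
| "jump_if (RLess i j) l = RJumpLess i j l"

datatype com =
    Skip
  | Basic instr
  | Seq com com (infixr "Then" 60)
  | Cond test com com
  | While test com

fun code_length :: "com \<Rightarrow> nat" where
  "code_length Skip = 0"
| "code_length (Basic i) = 1"
| "code_length (Seq c d) = code_length c + code_length d"
| "code_length (Cond b c d) = code_length c + code_length d + 2"
| "code_length (While b c) = code_length c + 3"

text \<open>Conditional jumps are taken only if the test holds. Therefore the else branch comes
  first, and a loop needs a second, unconditional jump for leaving.\<close>

fun compile :: "nat \<Rightarrow> com \<Rightarrow> instr list" where
  "compile l Skip = []"
| "compile l (Basic i) = [i]"
| "compile l (Seq c d) = compile l c @ compile (l + code_length c) d"
| "compile l (Cond b c d) =
     [jump_if b (l + code_length d + 2)] @ compile (l + 1) d @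
     [Jump (l + code_length c + code_length d + 2)] @ compile (l + code_length d + 2) c"
| "compile l (While b c) =
     [jump_if b (l + 2), Jump (l + code_length c + 3)] @ compile (l + 2) c @ [Jump l]"

lemma length_compile [simp]: "length (compile l c) = code_length c"
  by (induction c arbitrary: l) auto

fun jump_free :: "instr \<Rightarrow> bool" where
  "jump_free (Jump l) = False"
| "jump_free (JumpLess i j l) = False"
| "jump_free (RJumpLess i j l) = False"
| "jump_free _ = True"

fun loop_free :: "com \<Rightarrow> bool" where
  "loop_free Skip = True"
| "loop_free (Basic i) = jump_free i"
| "loop_free (Seq c d) = (loop_free c \<and> loop_free d)"
| "loop_free (Cond b c d) = (loop_free c \<and> loop_free d)"
| "loop_free (While b c) = False"

text \<open>The value for \<open>While\<close> is a dummy; the function is meant for loop-free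
  programs.\<close>

fun sem :: "com \<Rightarrow> ram \<Rightarrow> ram" where
  "sem Skip s = s"
| "sem (Basic i) s = exec_instr i s"
| "sem (Seq c d) s = sem d (sem c s)"
| "sem (Cond b c d) s = (if holds b s then sem c s else sem d s)"
| "sem (While b c) s = s"

section \<open>Execution of compiled code inside a larger program\<close>

definition code_at :: "instr list \<Rightarrow> nat \<Rightarrow> instr list \<Rightarrow> bool" where
  "code_at P l c \<longleftrightarrow> (\<exists>xs ys. P = xs @ c @ ys \<and> length xs = l)"

lemma code_at_append:
  "code_at P l (c @ d) \<longleftrightarrow> code_at P l c \<and> code_at P (l + length c) d"
proof
  assume "code_at P l (c @ d)"
  then obtain xs ys where "P = xs @ c @ d @ ys" "length xs = l"
    by (auto simp: code_at_def)
  then show "code_at P l c \<and> code_at P (l + length c) d"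
    unfolding code_at_def
    by (metis append.assoc length_append)
next
  assume "code_at P l c \<and> code_at P (l + length c) d"
  then obtain xs ys us vs where *: "P = xs @ c @ ys" "length xs = l"
      "P = us @ d @ vs" "length us = l + length c"
    unfolding code_at_def by blast
  then have "us = xs @ c" by (metis append.assoc append_eq_append_conv length_append)
  with * show "code_at P l (c @ d)" unfolding code_at_def by auto
qed

lemma code_at_Cons:
  "code_at P l (i # d) \<longleftrightarrow> code_at P l [i] \<and> code_at P (Suc l) d"
  using code_at_append[of P l "[i]" d] by simp

lemma step_code_at:
  assumes "code_at P l [i]" "pc s = l"
  shows "step P s = exec_instr i s"
  using assms by (auto simp: code_at_def step_def halted_def nth_append)

lemma funpow_add_trans:
  assumes "(f ^^ j) x = y" "(f ^^ k) y = z"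
  shows "(f ^^ (j + k)) x = z"
  using assms by (simp add: add.commute[of j] funpow_add)

text \<open>The code may sit anywhere in any program, and the program counters of both states are
  overwritten; this makes the relation compositional.\<close>

definition runs :: "com \<Rightarrow> ram \<Rightarrow> nat \<Rightarrow> ram \<Rightarrow> bool" where
  "runs c s k s' \<longleftrightarrow> (\<forall>P l. code_at P l (compile l c) \<longrightarrow>
     (step P ^^ k) (s\<lparr>pc := l\<rparr>) = s'\<lparr>pc := l + code_length c\<rparr>)"

lemma exec_jump_free:
  "jump_free i \<Longrightarrow> exec_instr i (s\<lparr>pc := l\<rparr>) = (exec_instr i s)\<lparr>pc := Suc l\<rparr>"
  by (cases i) auto

lemma exec_jump_if:
  "exec_instr (jump_if b l') (s\<lparr>pc := l\<rparr>) = s\<lparr>pc := (if holds b s then l' else Suc l)\<rparr>"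
  by (cases b) auto

lemma runs_Seq:
  assumes "runs c s j s'" "runs d s' k s''"
  shows "runs (Seq c d) s (j + k) s''"
  using assms unfolding runs_def
  by (auto simp: code_at_append add.assoc intro!: funpow_add_trans)

lemma runs_Cond_true:
  assumes "holds b s" "runs c s k s'"
  shows "runs (Cond b c d) s (1 + k) s'"
  unfolding runs_def
proof (intro allI impI)
  fix P l
  assume "code_at P l (compile l (Cond b c d))"
  then have 1: "code_at P l [jump_if b (l + code_length d + 2)]"
    and 2: "code_at P (l + code_length d + 2) (compile (l + code_length d + 2) c)"
    by (auto simp: code_at_append code_at_Cons[of _ _ _ "_ @ _"] code_at_Cons[of _ _ _ "compile _ _"])
  have "(step P ^^ 1) (s\<lparr>pc := l\<rparr>) = s\<lparr>pc := l + code_length d + 2\<rparr>"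
    using step_code_at[OF 1] assms by (simp add: exec_jump_if)
  moreover have "(step P ^^ k) (s\<lparr>pc := l + code_length d + 2\<rparr>) =
      s'\<lparr>pc := l + code_length d + 2 + code_length c\<rparr>"
    using assms(2) 2 unfolding runs_def by blast
  moreover have "l + code_length d + 2 + code_length c = l + code_length (Cond b c d)" by simp
  ultimately show "(step P ^^ (1 + k)) (s\<lparr>pc := l\<rparr>) = s'\<lparr>pc := l + code_length (Cond b c d)\<rparr>"
    by (metis funpow_add_trans)
qed

lemma runs_Cond_false:
  assumes "\<not> holds b s" "runs d s k s'"
  shows "runs (Cond b c d) s (1 + k + 1) s'"
  unfolding runs_def
proof (intro allI impI)
  fix P l
  assume "code_at P l (compile l (Cond b c d))"
  then have 1: "code_at P l [jump_if b (l + code_length d + 2)]"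
    and 2: "code_at P (l + 1) (compile (l + 1) d)"
    and 3: "code_at P (l + 1 + code_length d) [Jump (l + code_length c + code_length d + 2)]"
    by (auto simp: code_at_append code_at_Cons[of _ _ _ "_ @ _"] code_at_Cons[of _ _ _ "compile _ _"])
  have "(step P ^^ 1) (s\<lparr>pc := l\<rparr>) = s\<lparr>pc := l + 1\<rparr>"
    using step_code_at[OF 1] assms by (simp add: exec_jump_if)
  moreover have "(step P ^^ k) (s\<lparr>pc := l + 1\<rparr>) = s'\<lparr>pc := l + 1 + code_length d\<rparr>"
    using assms(2) 2 unfolding runs_def by blast
  moreover have "(step P ^^ 1) (s'\<lparr>pc := l + 1 + code_length d\<rparr>) =
      s'\<lparr>pc := l + code_length (Cond b c d)\<rparr>"
    using step_code_at[OF 3] by (simp add: algebra_simps)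
  ultimately show "(step P ^^ (1 + k + 1)) (s\<lparr>pc := l\<rparr>) = s'\<lparr>pc := l + code_length (Cond b c d)\<rparr>"
    using funpow_add_trans by metis
qed

lemma runs_While_step:
  assumes "holds b s" "runs c s j s'" "runs (While b c) s' k s''"
  shows "runs (While b c) s (1 + j + 1 + k) s''"
  unfolding runs_def
proof (intro allI impI)
  fix P l
  assume *: "code_at P l (compile l (While b c))"
  then have 1: "code_at P l [jump_if b (l + 2)]"
    and 2: "code_at P (l + 2) (compile (l + 2) c)"
    and 3: "code_at P (l + 2 + code_length c) [Jump l]"
    by (auto simp: code_at_append code_at_Cons[of _ _ _ "_ # _"] code_at_Cons[of _ _ _ "_ @ _"])
  have "(step P ^^ 1) (s\<lparr>pc := l\<rparr>) = s\<lparr>pc := l + 2\<rparr>"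
    using step_code_at[OF 1] assms by (simp add: exec_jump_if)
  moreover have "(step P ^^ j) (s\<lparr>pc := l + 2\<rparr>) = s'\<lparr>pc := l + 2 + code_length c\<rparr>"
    using assms(2) 2 unfolding runs_def by blast
  moreover have "(step P ^^ 1) (s'\<lparr>pc := l + 2 + code_length c\<rparr>) = s'\<lparr>pc := l\<rparr>"
    using step_code_at[OF 3] by simp
  moreover have "(step P ^^ k) (s'\<lparr>pc := l\<rparr>) = s''\<lparr>pc := l + code_length (While b c)\<rparr>"
    using assms(3) * unfolding runs_def by blast
  ultimately show "(step P ^^ (1 + j + 1 + k)) (s\<lparr>pc := l\<rparr>) =
      s''\<lparr>pc := l + code_length (While b c)\<rparr>"
    using funpow_add_trans by metis
qed

lemma runs_While_exit:
  assumes "\<not> holds b s"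
  shows "runs (While b c) s 2 s"
  unfolding runs_def
proof (intro allI impI)
  fix P l
  assume "code_at P l (compile l (While b c))"
  then have 1: "code_at P l [jump_if b (l + 2)]"
    and 2: "code_at P (l + 1) [Jump (l + code_length c + 3)]"
    by (auto simp: code_at_append code_at_Cons[of _ _ _ "_ # _"] code_at_Cons[of _ _ _ "_ @ _"])
  have "(step P ^^ 1) (s\<lparr>pc := l\<rparr>) = s\<lparr>pc := l + 1\<rparr>"
    using step_code_at[OF 1] assms by (simp add: exec_jump_if)
  moreover have "(step P ^^ 1) (s\<lparr>pc := l + 1\<rparr>) = s\<lparr>pc := l + code_length (While b c)\<rparr>"
    using step_code_at[OF 2] by (simp add: algebra_simps)
  ultimately show "(step P ^^ 2) (s\<lparr>pc := l\<rparr>) = s\<lparr>pc := l + code_length (While b c)\<rparr>"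
    using funpow_add_trans by (metis one_add_one)
qed

text \<open>Without loops every instruction is executed at most once, so the length of the code
  bounds the time.\<close>

lemma runs_sem:
  "loop_free c \<Longrightarrow> \<exists>k\<le>code_length c. runs c s k (sem c s)"
proof (induction c arbitrary: s)
  case Skip
  then show ?case by (auto simp: runs_def)
next
  case (Basic i)
  have "runs (Basic i) s 1 (exec_instr i s)"
    unfolding runs_def using Basic by (auto simp: step_code_at exec_jump_free)
  then show ?case by auto
next
  case (Seq c d)
  then obtain j k where "j \<le> code_length c" "runs c s j (sem c s)"
    "k \<le> code_length d" "runs d (sem c s) k (sem d (sem c s))"
    by (meson loop_free.simps(3))
  then show ?case by (metis add_mono code_length.simps(3) runs_Seq sem.simps(3))
next
  case (Cond b c d)
  then obtain j k where *: "j \<le> code_length c" "runs c s j (sem c s)"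
    "k \<le> code_length d" "runs d s k (sem d s)"
    by (meson loop_free.simps(4))
  show ?case
  proof (cases "holds b s")
    case True
    from runs_Cond_true[OF True *(2), of d] True *(1) show ?thesis
      by (intro exI[of _ "1 + j"]) auto
  next
    case False
    from runs_Cond_false[OF False *(4), of c] False *(3) show ?thesis
      by (intro exI[of _ "1 + k + 1"]) auto
  qed
qed simp

section \<open>Total correctness with time bounds\<close>

definition triple :: "(ram \<Rightarrow> bool) \<Rightarrow> com \<Rightarrow> nat \<Rightarrow> (ram \<Rightarrow> bool) \<Rightarrow> bool" where
  "triple A c t B \<longleftrightarrow> (\<forall>s. A s \<longrightarrow> (\<exists>k\<le>t. \<exists>s'. runs c s k s' \<and> B s'))"

lemma triple_Seq:
  assumes "triple A c t B" "triple B d u C"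
  shows "triple A (Seq c d) (t + u) C"
  unfolding triple_def
proof (intro allI impI)
  fix s assume "A s"
  with assms(1) obtain j s' where "j \<le> t" "runs c s j s'" "B s'" unfolding triple_def by blast
  with assms(2) obtain k s'' where "k \<le> u" "runs d s' k s''" "C s''" unfolding triple_def by blast
  with \<open>j \<le> t\<close> \<open>runs c s j s'\<close> runs_Seq show "\<exists>k\<le>t + u. \<exists>s'. runs (Seq c d) s k s' \<and> C s'"
    by (meson add_mono)
qed

lemma triple_loop_free:
  assumes "loop_free c" "\<And>s. A s \<Longrightarrow> B (sem c s)"
  shows "triple A c (code_length c) B"
  using assms runs_sem unfolding triple_def by blast

text \<open>With the number \<open>N\<close> of rounds fixed beforehand, termination and time come
  from one induction on the rounds left. A round adds the test and the jump back; leaving costs the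
  failed test and a jump.\<close>

lemma triple_While:
  assumes "loop_free c"
    and step: "\<And>i s. i < N \<Longrightarrow> I i s \<Longrightarrow> holds b s \<and> I (Suc i) (sem c s)"
    and exit: "\<And>s. I N s \<Longrightarrow> \<not> holds b s"
  shows "triple (I 0) (While b c) (N * (code_length c + 2) + 2) (I N)"
proof -
  have "\<exists>k\<le>m * (code_length c + 2) + 2. \<exists>s'. runs (While b c) s k s' \<and> I N s'"
    if "I (N - m) s" "m \<le> N" for m s
    using that
  proof (induction m arbitrary: s)
    case 0
    then have "runs (While b c) s 2 s" "I N s" using exit runs_While_exit by auto
    then show ?case by (intro exI[of _ 2] conjI exI[of _ s]) auto
  next
    case (Suc m)
    then have b: "holds b s" and "I (N - m) (sem c s)"
      using step[of "N - Suc m" s] by (auto simp: Suc_diff_Suc)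
    then obtain k s' where k: "k \<le> m * (code_length c + 2) + 2" "runs (While b c) (sem c s) k s'" "I N s'"
      using Suc by (meson Suc_leD)
    obtain j where "j \<le> code_length c" "runs c s j (sem c s)"
      using runs_sem assms(1) by blast
    with runs_While_step[OF b this(2) k(2)] k show ?case
      by (intro exI[of _ "1 + j + 1 + k"] conjI exI[of _ s']) auto
  qed
  from this[of N] show ?thesis unfolding triple_def by simp
qed

lemma halts_within_compile:
  assumes "triple A c t B" "A s" "pc s = 0"
  shows "\<exists>s'. B s' \<and> halts_within (compile 0 c) s t (s'\<lparr>pc := code_length c\<rparr>)"
proof -
  from assms obtain k s' where k: "k \<le> t" "runs c s k s'" "B s'" unfolding triple_def by blast
  have "code_at (compile 0 c) 0 (compile 0 c)" unfolding code_at_def by auto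
  moreover have "s\<lparr>pc := 0\<rparr> = s" using assms(3) by simp
  ultimately have "(step (compile 0 c) ^^ k) s = s'\<lparr>pc := code_length c\<rparr>"
    using k(2) unfolding runs_def by (metis add_0)
  then have "halts_within (compile 0 c) s t (s'\<lparr>pc := code_length c\<rparr>)"
    using k(1) unfolding halts_within_def halted_def by auto
  with k(3) show ?thesis by auto
qed

section \<open>Voronoi cells on a line\<close>

text \<open>
  A map \<open>M\<close> on positions encodes a source list: \<open>M x = 0\<close> means that \<open>x\<close> is no source, and
  among sources smaller values of \<open>M\<close> win ties.
\<close>

definition line_dist :: "nat \<Rightarrow> nat \<Rightarrow> nat" where
  "line_dist x y = (x - y) + (y - x)"

definition sources :: "(nat \<Rightarrow> nat) \<Rightarrow> nat set" where
  "sources M = {s. 0 < M s}"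

definition beats :: "(nat \<Rightarrow> nat) \<Rightarrow> nat \<Rightarrow> nat \<Rightarrow> nat \<Rightarrow> bool" where
  "beats M s t x \<longleftrightarrow> line_dist x s < line_dist x t \<or> line_dist x s = line_dist x t \<and> M s < M t"

definition cell :: "(nat \<Rightarrow> nat) \<Rightarrow> nat \<Rightarrow> nat set" where
  "cell M s = {x. \<forall>t\<in>sources M. t \<noteq> s \<longrightarrow> beats M s t x}"

definition border :: "(nat \<Rightarrow> nat) \<Rightarrow> nat \<Rightarrow> nat \<Rightarrow> nat" where
  "border M s t = (if M s < M t then s + t + 1 else s + t)"

lemma beats_left_iff: "s < t \<Longrightarrow> beats M s t x \<longleftrightarrow> 2 * x < border M s t"
  unfolding beats_def line_dist_def border_def by auto

text \<open>Distinct marks let exactly one of two sources win each position, so this is the negation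
  of the condition for \<open>s\<close>.\<close>

lemma beats_right_iff: "s < t \<Longrightarrow> M s \<noteq> M t \<Longrightarrow> beats M t s x \<longleftrightarrow> border M s t \<le> 2 * x"
  unfolding beats_def line_dist_def border_def by auto

definition left_end :: "(nat \<Rightarrow> nat) \<Rightarrow> nat \<Rightarrow> nat \<Rightarrow> bool" where
  "left_end M a l \<longleftrightarrow> l \<le> 2 * a \<and> (\<forall>x. l \<le> 2 * x \<longleftrightarrow> (\<forall>s\<in>sources M. s < a \<longrightarrow> beats M a s x))"

text \<open>Limited to \<open>x < L\<close> because the last source has no competitor on its right
  and only the end of the line bounds its cell. On the left, 0 is a bound for all positions.\<close>

definition right_end :: "(nat \<Rightarrow> nat) \<Rightarrow> nat \<Rightarrow> nat \<Rightarrow> nat \<Rightarrow> bool" where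
  "right_end M L b h \<longleftrightarrow> 2 * b < h \<and> (\<forall>x<L. 2 * x < h \<longleftrightarrow> (\<forall>s\<in>sources M. b < s \<longrightarrow> beats M b s x))"

definition weight_below :: "(nat \<Rightarrow> real) \<Rightarrow> nat \<Rightarrow> nat \<Rightarrow> real" where
  "weight_below w L j = (\<Sum>x | x < L \<and> 2 * x < j. w x)"

definition cell_load :: "(nat \<Rightarrow> real) \<Rightarrow> nat \<Rightarrow> (nat \<Rightarrow> nat) \<Rightarrow> nat \<Rightarrow> real" where
  "cell_load w L M s = (\<Sum>x | x < L \<and> x \<in> cell M s. w x)"

lemma weight_below_0 [simp]: "weight_below w L 0 = 0"
  by (simp add: weight_below_def)

lemma weight_below_odd:
  assumes "x < L"
  shows "weight_below w L (Suc (2 * x)) = weight_below w L (2 * x) + w x"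
proof -
  have "{y. y < L \<and> 2 * y < Suc (2 * x)} = insert x {y. y < L \<and> 2 * y < 2 * x}"
    using assms by auto
  then show ?thesis by (simp add: weight_below_def)
qed

lemma weight_below_even: "weight_below w L (Suc (Suc (2 * x))) = weight_below w L (Suc (2 * x))"
proof -
  have "{y. y < L \<and> 2 * y < Suc (Suc (2 * x))} = {y. y < L \<and> 2 * y < Suc (2 * x)}"
    by auto presburger
  then show ?thesis by (simp add: weight_below_def)
qed

lemma cell_load_eq:
  assumes "left_end M a l" "right_end M L a h"
  shows "cell_load w L M a = weight_below w L h - weight_below w L l"
proof -
  have "{x. x < L \<and> 2 * x < h} = {x. x < L \<and> 2 * x < l} \<union> {x. x < L \<and> x \<in> cell M a}"
    and "{x. x < L \<and> 2 * x < l} \<inter> {x. x < L \<and> x \<in> cell M a} = {}"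
  proof -
    have *: "x \<in> cell M a \<longleftrightarrow> l \<le> 2 * x \<and> 2 * x < h" if "x < L" for x
    proof -
      have "x \<in> cell M a \<longleftrightarrow> (\<forall>s\<in>sources M. s < a \<longrightarrow> beats M a s x) \<and> (\<forall>s\<in>sources M. a < s \<longrightarrow> beats M a s x)"
        unfolding cell_def by (auto simp: nat_neq_iff)
      with assms that show ?thesis unfolding left_end_def right_end_def by auto
    qed
    \<comment> \<open>The position \<open>a\<close> itself separates the two ends, so the smaller
      prefix is contained in the larger one.\<close>
    have "l < h" using assms unfolding left_end_def right_end_def by auto
    with * show "{x. x < L \<and> 2 * x < h} = {x. x < L \<and> 2 * x < l} \<union> {x. x < L \<and> x \<in> cell M a}"
      and "{x. x < L \<and> 2 * x < l} \<inter> {x. x < L \<and> x \<in> cell M a} = {}"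
      by auto
  qed
  then show ?thesis
    unfolding weight_below_def cell_load_def by (simp add: sum.union_disjoint)
qed

lemma Max_insert_0_image:
  fixes f :: "nat \<Rightarrow> real"
  assumes "finite X"
  shows "Max (insert 0 (f ` insert b X)) = max (Max (insert 0 (f ` X))) (f b)"
proof -
  have "insert 0 (f ` insert b X) = insert (f b) (insert 0 (f ` X))" by auto
  then show ?thesis using assms by (simp del: Max_insert add: Max_insert[of "insert 0 (f ` X)"] max.commute)
qed

text \<open>The nearest source alone decides: a source farther left moves the border with
  \<open>b\<close> by at least 1 to the left, while the tie rule can move it back by at most
  1.\<close>

lemma left_end_next:
  assumes "a \<in> sources M" "b \<in> sources M" "a < b" "\<And>j. a < j \<Longrightarrow> j < b \<Longrightarrow> M j = 0"
    "inj_on M (sources M)"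
  shows "left_end M b (border M a b)"
proof -
  have 1: "beats M b s x \<longleftrightarrow> border M s b \<le> 2 * x" if "s \<in> sources M" "s < b" for s x
    using that assms beats_right_iff[of s b M x] by (auto simp: inj_on_def)
  have 2: "s \<le> a" if "s \<in> sources M" "s < b" for s
    using assms(4)[of s] that by (fastforce simp: sources_def)
  have 3: "border M s b \<le> border M a b" if "s \<le> a" for s
    using that by (cases "s = a") (auto simp: border_def)
  have "border M a b \<le> 2 * b" using assms(3) by (auto simp: border_def)
  moreover have "border M a b \<le> 2 * x \<longleftrightarrow> (\<forall>s\<in>sources M. s < b \<longrightarrow> beats M b s x)" for x
    using 1 2 3 assms(1,3) by (meson order_trans)
  ultimately show ?thesis unfolding left_end_def by blast
qed

lemma right_end_next:
  assumes "a \<in> sources M" "b \<in> sources M" "a < b" "\<And>j. a < j \<Longrightarrow> j < b \<Longrightarrow> M j = 0"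
  shows "right_end M L a (border M a b)"
proof -
  have 2: "b \<le> s" if "s \<in> sources M" "a < s" for s
    using assms(4)[of s] that by (fastforce simp: sources_def)
  have 3: "border M a b \<le> border M a s" if "b \<le> s" for s
    using that by (cases "s = b") (auto simp: border_def)
  have "2 * a < border M a b" using assms(3) by (auto simp: border_def)
  moreover have "2 * x < border M a b \<longleftrightarrow> (\<forall>s\<in>sources M. a < s \<longrightarrow> beats M a s x)" for x
    using beats_left_iff 2 3 assms(2,3) by (meson order_less_le_trans)
  ultimately show ?thesis unfolding right_end_def by blast
qed

section \<open>Sweep data and the effect of a new source\<close>

locale weighted_line =
  fixes w :: "nat \<Rightarrow> real" and L :: nat and M :: "nat \<Rightarrow> nat"
  assumes w_nonneg: "\<And>x. 0 \<le> w x"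
    and sources_less: "sources M \<subseteq> {..<L}"
    and inj_M: "inj_on M (sources M)"
begin

abbreviation "D \<equiv> weight_below w L"

lemma finite_sources [simp]: "finite (sources M)"
  using sources_less finite_subset by blast

lemma finite_sources': "finite {s \<in> sources M. P s}"
  by simp

text \<open>Only the prefix sum at the left end is kept, not the end itself. The load of
  \<open>a\<close> is missing from \<open>r\<close> because its right border is still open. The 0 in
  the maximum serves the case that no source precedes \<open>a\<close>.\<close>

definition left_info :: "nat \<Rightarrow> nat \<Rightarrow> real \<Rightarrow> real \<Rightarrow> bool" where
  "left_info k a u r \<longleftrightarrow> a \<in> sources M \<and> a < k \<and> (\<forall>j. a < j \<and> j < k \<longrightarrow> M j = 0) \<and>
     (\<exists>l. left_end M a l \<and> u = D l) \<and>
     r = Max (insert 0 (cell_load w L M ` {s \<in> sources M. s < a}))"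

definition right_info :: "nat \<Rightarrow> nat \<Rightarrow> real \<Rightarrow> real \<Rightarrow> bool" where
  "right_info k b u r \<longleftrightarrow> b \<in> sources M \<and> k \<le> b \<and> (\<forall>j. k \<le> j \<and> j < b \<longrightarrow> M j = 0) \<and>
     (\<exists>h. right_end M L b h \<and> u = D h) \<and>
     r = Max (insert 0 (cell_load w L M ` {s \<in> sources M. b < s}))"

lemma right_info_skip: "right_info (Suc k) b u r \<Longrightarrow> M k = 0 \<Longrightarrow> right_info k b u r"
  unfolding right_info_def by (metis Suc_leD Suc_leI le_neq_implies_less)

lemma left_info_skip: "left_info k a u r \<Longrightarrow> M k = 0 \<Longrightarrow> left_info (Suc k) a u r"
  unfolding left_info_def by (metis less_SucE less_SucI)

text \<open>Meeting \<open>k\<close> closes the cell of \<open>b\<close> on the left, so its load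
  can enter the maximum; the same border is the right end of \<open>k\<close>.\<close>

lemma right_info_source:
  assumes "right_info (Suc k) b u r" "0 < M k"
  shows "right_info k k (D (border M k b)) (max r (u - D (border M k b)))"
proof -
  from assms obtain h where b: "b \<in> sources M" "k < b" "\<And>j. k < j \<Longrightarrow> j < b \<Longrightarrow> M j = 0"
    and h: "right_end M L b h" "u = D h"
    and r: "r = Max (insert 0 (cell_load w L M ` {s \<in> sources M. b < s}))"
    unfolding right_info_def by auto
  have k: "k \<in> sources M" using assms(2) by (simp add: sources_def)
  have "left_end M b (border M k b)" using left_end_next[OF k b inj_M] .
  then have "cell_load w L M b = u - D (border M k b)"
    using cell_load_eq h by blast
  moreover have "{s \<in> sources M. k < s} = insert b {s \<in> sources M. b < s}"
    using b(1,2) b(3) by (auto simp: sources_def) (metis linorder_neqE_nat less_numeral_extra(3))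
  ultimately have "max r (u - D (border M k b)) = Max (insert 0 (cell_load w L M ` {s \<in> sources M. k < s}))"
    using r by (simp only: Max_insert_0_image[OF finite_sources'])
  moreover have "right_end M L k (border M k b)" using right_end_next[OF k b] .
  ultimately show ?thesis unfolding right_info_def using k by auto
qed

lemma left_info_source:
  assumes "left_info k a u r" "0 < M k"
  shows "left_info (Suc k) k (D (border M a k)) (max r (D (border M a k) - u))"
proof -
  from assms obtain l where a: "a \<in> sources M" "a < k" "\<And>j. a < j \<Longrightarrow> j < k \<Longrightarrow> M j = 0"
    and l: "left_end M a l" "u = D l"
    and r: "r = Max (insert 0 (cell_load w L M ` {s \<in> sources M. s < a}))"
    unfolding left_info_def by auto
  have k: "k \<in> sources M" using assms(2) by (simp add: sources_def)
  have "right_end M L a (border M a k)" using right_end_next[OF a(1) k a(2,3)] .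
  then have "cell_load w L M a = D (border M a k) - u"
    using cell_load_eq l by blast
  moreover have "{s \<in> sources M. s < k} = insert a {s \<in> sources M. s < a}"
    using a(1,2) a(3) by (auto simp: sources_def) (metis linorder_neqE_nat less_numeral_extra(3))
  ultimately have "max r (D (border M a k) - u) = Max (insert 0 (cell_load w L M ` {s \<in> sources M. s < k}))"
    using r by (simp only: Max_insert_0_image[OF finite_sources'])
  moreover have "left_end M k (border M a k)" using left_end_next[OF a(1) k a(2,3) inj_M] .
  ultimately show ?thesis unfolding left_info_def using k by auto
qed

lemma right_info_last:
  assumes "Suc b = L" "0 < M b" "k \<le> b" "\<And>j. k \<le> j \<Longrightarrow> j < b \<Longrightarrow> M j = 0"
  shows "right_info k b (D (2 * L)) 0"
proof -
  have *: "{s \<in> sources M. b < s} = {}" using sources_less assms(1) by auto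
  then have "right_end M L b (2 * L)" using assms(1) unfolding right_end_def by auto
  then show ?thesis using assms unfolding right_info_def * by (auto simp: sources_def)
qed

lemma left_info_first:
  assumes "0 < M 0" "\<And>j. 0 < j \<Longrightarrow> j < k \<Longrightarrow> M j = 0" "0 < k"
  shows "left_info k 0 0 0"
proof -
  have "left_end M 0 0" unfolding left_end_def by auto
  then show ?thesis using assms unfolding left_info_def by (auto simp: sources_def intro!: exI[of _ 0])
qed

lemma cell_load_nonneg: "0 \<le> cell_load w L M' s"
  unfolding cell_load_def by (intro sum_nonneg w_nonneg)

lemma cell_load_le_total: "cell_load w L M' s \<le> D (2 * L)"
  unfolding cell_load_def weight_below_def by (intro sum_mono2) (auto simp: w_nonneg)

text \<open>The value \<open>m\<close> is meant to exceed all marks, so that the new source \<open>k\<close> loses every tie.\<close>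

definition load_with :: "nat \<Rightarrow> nat \<Rightarrow> real" where
  "load_with m k = Max (cell_load w L (M(k := m)) ` insert k (sources M))"

lemma load_with_le_total: "load_with m k \<le> D (2 * L)"
  unfolding load_with_def using cell_load_le_total by (subst Max_le_iff) auto

text \<open>A position that a source left of \<open>a\<close> wins against \<open>a\<close> it also
  wins against \<open>k\<close>, which lies farther away; symmetrically to the right of
  \<open>b\<close>. So only \<open>a\<close>, \<open>k\<close> and \<open>b\<close> need new loads,
  and each of their ends is either already known or a border with \<open>k\<close>.\<close>

lemma load_with_eq:
  assumes li: "left_info k a u r" and ri: "right_info k b v t" and k: "M k = 0"
    and m: "\<And>s. M s < m"
  shows "load_with m k =
    max (max (max (max r t) (D (a + k + 1) - u)) (D (k + b) - D (a + k + 1))) (v - D (k + b))"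
proof -
  let ?M = "M(k := m)" and ?S = "sources M"
  from li obtain l where a: "a \<in> ?S" "a < k" "\<And>j. a < j \<Longrightarrow> j < k \<Longrightarrow> M j = 0"
    and l: "left_end M a l" "u = D l"
    and r: "r = Max (insert 0 (cell_load w L M ` {s \<in> ?S. s < a}))"
    unfolding left_info_def by auto
  from ri k obtain h where b: "b \<in> ?S" "k < b" "\<And>j. k < j \<Longrightarrow> j < b \<Longrightarrow> M j = 0"
    and h: "right_end M L b h" "v = D h"
    and t: "t = Max (insert 0 (cell_load w L M ` {s \<in> ?S. b < s}))"
    unfolding right_info_def sources_def by (auto simp: le_less)
  have S': "sources ?M = insert k ?S" using m[of k] by (auto simp: sources_def)
  have kS: "k \<notin> ?S" using k by (simp add: sources_def)
  have inj': "inj_on ?M (sources ?M)"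
    using inj_M m kS unfolding S' inj_on_def by (auto simp: less_le)
  have beats': "beats ?M s s' x = beats M s s' x" if "s \<in> ?S" "s' \<in> ?S" for s s' x
    using that kS unfolding beats_def by auto
  \<comment> \<open>\<open>k\<close> has the largest mark and loses ties on both sides: borders to
    its left carry the extra 1, borders to its right do not.\<close>
  have bl: "border ?M s k = s + k + 1" if "s \<in> ?S" for s
    using that kS m[of s] by (auto simp: border_def)
  have br: "border ?M k s = k + s" if "s \<in> ?S" for s
    using that kS m[of s] by (auto simp: border_def)
  have left: "cell_load w L ?M s = cell_load w L M s" if s: "s \<in> ?S" "s < a" for s
  proof -
    have "beats ?M s k x" if "x \<in> cell M s" for x
    proof -
      have "beats M s a x" using that s a(1) unfolding cell_def by auto
      then have "2 * x < border M s a" using s by (simp add: beats_left_iff)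
      then have "2 * x < s + k + 1" using a(2) by (auto simp: border_def split: if_splits)
      then show ?thesis using s a(2) bl[of s] by (simp add: beats_left_iff)
    qed
    then have "cell ?M s = cell M s"
      using beats' s unfolding cell_def S' by auto
    then show ?thesis by (simp add: cell_load_def)
  qed
  have right: "cell_load w L ?M s = cell_load w L M s" if s: "s \<in> ?S" "b < s" for s
  proof -
    have "beats ?M s k x" if "x \<in> cell M s" for x
    proof -
      have "beats M s b x" using that s b(1) unfolding cell_def by auto
      moreover have "M b \<noteq> M s" using inj_M s b(1) by (auto simp: inj_on_def)
      ultimately have "border M b s \<le> 2 * x" using s by (simp add: beats_right_iff)
      then have "k + s \<le> 2 * x" using b(2) by (auto simp: border_def split: if_splits)
      then show ?thesis using s b(2) br[of s] m[of s] by (simp add: beats_right_iff)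
    qed
    then have "cell ?M s = cell M s"
      using beats' s unfolding cell_def S' by auto
    then show ?thesis by (simp add: cell_load_def)
  qed
  have S'k: "k \<in> sources ?M" "a \<in> sources ?M" "b \<in> sources ?M" using a b S' by auto
  have na: "\<And>j. a < j \<Longrightarrow> j < k \<Longrightarrow> ?M j = 0" and nb: "\<And>j. k < j \<Longrightarrow> j < b \<Longrightarrow> ?M j = 0"
    using a(3) b(3) by auto
  have "left_end ?M a l" using l(1) a(1,2) beats' unfolding left_end_def S' by auto
  moreover have "right_end ?M L a (a + k + 1)"
    using right_end_next[OF S'k(2,1) a(2)] na bl[OF a(1)] by metis
  ultimately have la: "cell_load w L ?M a = D (a + k + 1) - u"
    using cell_load_eq l(2) by blast
  have "right_end ?M L b h" using h(1) b(1,2) beats' unfolding right_end_def S' by auto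
  moreover have "left_end ?M b (k + b)"
    using left_end_next[OF S'k(1,3) b(2) _ inj'] nb br[OF b(1)] by metis
  ultimately have lb: "cell_load w L ?M b = v - D (k + b)"
    using cell_load_eq h(2) by blast
  have "left_end ?M k (a + k + 1)"
    using left_end_next[OF S'k(2,1) a(2) _ inj'] na bl[OF a(1)] by metis
  moreover have "right_end ?M L k (k + b)"
    using right_end_next[OF S'k(1,3) b(2)] nb br[OF b(1)] by metis
  ultimately have lk: "cell_load w L ?M k = D (k + b) - D (a + k + 1)"
    using cell_load_eq by blast
  have split: "?S = {s \<in> ?S. s < a} \<union> {s \<in> ?S. b < s} \<union> {a, b}"
    using a b k by (auto simp: sources_def) (metis less_numeral_extra(3) linorder_neqE_nat)
  let ?A = "cell_load w L M ` {s \<in> ?S. s < a}" and ?B = "cell_load w L M ` {s \<in> ?S. b < s}"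
  have "cell_load w L ?M ` insert k ?S =
      ?A \<union> ?B \<union> {cell_load w L ?M a, cell_load w L ?M k, cell_load w L ?M b}"
    by (subst split) (auto simp: image_Un left right)
  \<comment> \<open>Loads are nonnegative, so 0 may be inserted. It is wanted because the maxima
    \<open>r\<close> and \<open>t\<close> contain it, and their sets of sources may be
    empty.\<close>
  moreover have "Max (insert 0 X) = Max X" if "finite X" "x \<in> X" "0 \<le> x" for X :: "real set" and x
    using that by (metis Max_ge Max_insert dual_order.trans empty_iff max.absorb2)
  ultimately have "load_with m k =
      Max (insert 0 (?A \<union> ?B \<union> {cell_load w L ?M a, cell_load w L ?M k, cell_load w L ?M b}))"
    unfolding load_with_def using cell_load_nonneg[of ?M a] by auto
  also have "insert 0 (?A \<union> ?B \<union> {cell_load w L ?M a, cell_load w L ?M k, cell_load w L ?M b}) =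
      (insert 0 ?A \<union> insert 0 ?B) \<union> {cell_load w L ?M a, cell_load w L ?M k, cell_load w L ?M b}"
    by auto
  also have "Max \<dots> = max (max r t) (Max {cell_load w L ?M a, cell_load w L ?M k, cell_load w L ?M b})"
    unfolding r t by (subst Max_Un, simp, simp, simp, simp, subst Max_Un, simp_all only: finite_insert finite_imageI finite_sources') simp_all
  finally show ?thesis by (simp add: la lb lk max.assoc)
qed

end

section \<open>Paths as padded lines\<close>

text \<open>Positions are counted from 1 so that 0 can mean "no source", which is also what
  untouched memory contains.\<close>

definition priority :: "'a list \<Rightarrow> 'a \<Rightarrow> nat" where
  "priority S v = (if v \<in> set S then Suc (LEAST j. j < length S \<and> S ! j = v) else 0)"

lemma priority_pos_iff [simp]: "0 < priority S v \<longleftrightarrow> v \<in> set S"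
  by (simp add: priority_def)

lemma priority_eq_0_iff [simp]: "priority S v = 0 \<longleftrightarrow> v \<notin> set S"
  by (simp add: priority_def)

lemma priority_nth [simp]: "distinct S \<Longrightarrow> j < length S \<Longrightarrow> priority S (S ! j) = Suc j"
  by (auto simp: priority_def nth_eq_iff_index_eq intro!: Least_equality)

lemma priority_append:
  assumes "distinct (S @ [v])" "u \<in> set S"
  shows "priority (S @ [v]) u = priority S u"
proof -
  obtain j where "j < length S" "u = S ! j" using assms(2) by (auto simp: in_set_conv_nth)
  then show ?thesis using assms(1) priority_nth[of "S @ [v]" j] by (simp add: nth_append)
qed

lemma priority_le: "distinct S \<Longrightarrow> priority S v \<le> length S"
  by (metis Suc_leI in_set_conv_nth le0 priority_eq_0_iff priority_nth)

lemma priority_inj: "distinct S \<Longrightarrow> u \<in> set S \<Longrightarrow> priority S u = priority S v \<Longrightarrow> u = v"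
  by (metis Suc_inject in_set_conv_nth priority_eq_0_iff priority_nth)

text \<open>Trades the minimum over the list for pairwise comparisons, the shape in which
  \<open>cell\<close> is given; tie breaking becomes a comparison of list positions.\<close>

lemma in_territory_iff:
  assumes "i < length S"
  shows "v \<in> territory V E S i \<longleftrightarrow> v \<in> V \<and> (\<forall>j<length S. j \<noteq> i \<longrightarrow>
    graph_dist V E v (S ! i) < graph_dist V E v (S ! j) \<or>
    graph_dist V E v (S ! i) = graph_dist V E v (S ! j) \<and> i < j)"
    (is "_ \<longleftrightarrow> _ \<and> (\<forall>j<_. _ \<longrightarrow> ?d i < ?d j \<or> _)")
proof -
  have le: "dist_list V E v S \<le> ?d j" if "j < length S" for j
    using that unfolding dist_list_def by simp
  have eq: "dist_list V E v S = ?d i \<longleftrightarrow> (\<forall>j<length S. ?d i \<le> ?d j)"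
  proof
    assume "\<forall>j<length S. ?d i \<le> ?d j"
    then show "dist_list V E v S = ?d i"
      unfolding dist_list_def using assms by (intro Min_eqI) (auto simp: in_set_conv_nth[of _ S] intro!: imageI nth_mem)
  qed (use le in auto)
  show ?thesis
  proof (intro iffI conjI allI impI)
    fix j assume "v \<in> territory V E S i" "j < length S" "j \<noteq> i"
    then show "?d i < ?d j \<or> ?d i = ?d j \<and> i < j"
      using le[of j] unfolding territory_def by (cases "j < i") auto
  next
    assume r: "v \<in> V \<and> (\<forall>j<length S. j \<noteq> i \<longrightarrow> ?d i < ?d j \<or> ?d i = ?d j \<and> i < j)"
    then have "\<forall>j<length S. ?d i \<le> ?d j" by (metis le_less)
    moreover have "?d i < ?d j" if "j < i" for j
      using r[THEN conjunct2, rule_format, of j] that assms by auto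
    ultimately show "v \<in> territory V E S i"
      using r eq unfolding territory_def by auto
  qed (simp add: territory_def)
qed

section \<open>Distances in a path\<close>

locale path_graph =
  fixes n :: nat and E :: "nat set set" and vs :: "nat list"
  assumes n_pos: "0 < n"
    and distinct_vs: "distinct vs"
    and set_vs: "set vs = {..<n}"
    and E_eq: "E = {{vs ! i, vs ! Suc i} | i. Suc i < length vs}"
begin

lemma length_vs [simp]: "length vs = n"
  using distinct_card[OF distinct_vs] set_vs by simp

lemma vs_less [simp]: "i < n \<Longrightarrow> vs ! i < n"
  using set_vs nth_mem[of i vs] by auto

lemma vs_eq_iff [simp]: "i < n \<Longrightarrow> j < n \<Longrightarrow> vs ! i = vs ! j \<longleftrightarrow> i = j"
  using nth_eq_iff_index_eq[OF distinct_vs] by simp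

lemma ex_position: "v < n \<Longrightarrow> \<exists>i<n. v = vs ! i"
  using set_vs by (metis in_set_conv_nth length_vs lessThan_iff)

lemma edge_iff: "i < n \<Longrightarrow> j < n \<Longrightarrow> {vs ! i, vs ! j} \<in> E \<longleftrightarrow> j = Suc i \<or> i = Suc j"
  unfolding E_eq by (auto simp: doubleton_eq_iff Suc_lessD)

text \<open>Every edge joins positions that differ by one, so a walk cannot advance faster than one
  position per edge.\<close>

lemma walk_length:
  assumes "successively (\<lambda>x y. {x, y} \<in> E) xs" "set xs \<subseteq> {..<n}" "xs \<noteq> []"
    "hd xs = vs ! i" "last xs = vs ! j" "i < n" "j < n"
  shows "line_dist i j < length xs"
  using assms
proof (induction xs arbitrary: i)
  case (Cons x xs)
  show ?case
  proof (cases xs)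
    case Nil
    then show ?thesis using Cons.prems by (auto simp: line_dist_def)
  next
    case (Cons y ys)
    with Cons.prems ex_position[of y] obtain i' where i': "i' < n" "y = vs ! i'" by auto
    with Cons.prems Cons have "i' = Suc i \<or> i = Suc i'" using edge_iff[of i i'] by auto
    moreover have "line_dist i' j < length xs"
      using Cons.IH[of i'] Cons.prems i' Cons by auto
    ultimately show ?thesis by (auto simp: line_dist_def)
  qed
qed simp

lemma walk_forward:
  assumes "i \<le> j" "j < n"
  shows "walk_betw {..<n} E (vs ! i) (map ((!) vs) [i..<Suc j]) (vs ! j)"
proof -
  have "successively (\<lambda>x y. {x, y} \<in> E) (map ((!) vs) [i..<Suc j])"
    using assms by (auto simp: successively_conv_nth edge_iff simp del: upt_Suc)
  then show ?thesis
    using assms unfolding walk_betw_def by (auto simp: hd_map last_map simp del: upt_Suc)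
qed

lemma walk_rev: "walk_betw V F u xs v \<Longrightarrow> walk_betw V F v (rev xs) u"
  unfolding walk_betw_def by (auto simp: hd_rev last_rev successively_rev insert_commute)

lemma graph_dist_path:
  assumes "i < n" "j < n"
  shows "graph_dist {..<n} E (vs ! i) (vs ! j) = line_dist i j"
  unfolding graph_dist_def
proof (rule Least_equality)
  show "\<exists>xs. walk_betw {..<n} E (vs ! i) xs (vs ! j) \<and> length xs = Suc (line_dist i j)"
  proof (cases "i \<le> j")
    case True
    then show ?thesis using walk_forward[of i j] assms
      by (intro exI[of _ "map ((!) vs) [i..<Suc j]"]) (auto simp: line_dist_def)
  next
    case False
    then show ?thesis using walk_rev[OF walk_forward[of j i]] assms
      by (intro exI[of _ "rev (map ((!) vs) [j..<Suc i])"]) (auto simp: line_dist_def)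
  qed
next
  fix k assume "\<exists>xs. walk_betw {..<n} E (vs ! i) xs (vs ! j) \<and> length xs = Suc k"
  then show "line_dist i j \<le> k"
    using walk_length assms unfolding walk_betw_def by (metis less_Suc_eq_le)
qed

text \<open>
  The vertex \<open>vs ! i\<close> sits at position \<open>n + i\<close> of a line of length \<open>3 * n\<close>.  The sentinels
  \<open>0\<close> and \<open>3 * n - 1\<close> are at distance at least \<open>n\<close> from all of them; they get marks of their
  own because the marks of sources have to be distinct.
\<close>

definition padded_weight :: "(nat \<Rightarrow> real) \<Rightarrow> nat \<Rightarrow> real" where
  "padded_weight \<pi> x = (if n \<le> x \<and> x < 2 * n then \<pi> (vs ! (x - n)) else 0)"

definition padded_mark :: "nat list \<Rightarrow> nat \<Rightarrow> nat" where
  "padded_mark S x = (if x = 0 then length S + 1 else if x = 3 * n - 1 then length S + 2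
     else if n \<le> x \<and> x < 2 * n then priority S (vs ! (x - n)) else 0)"

text \<open>Only the order of the marks matters for ties, so marks of sources on the path need not
  equal their priorities. This freedom is used for a new source, whose priority
  \<open>length S + 1\<close> would clash with the mark of a sentinel.\<close>

definition represents :: "(nat \<Rightarrow> nat) \<Rightarrow> nat list \<Rightarrow> bool" where
  "represents M S \<longleftrightarrow>
     sources M = {0, 3 * n - 1} \<union> (\<lambda>i. n + i) ` {i. i < n \<and> vs ! i \<in> set S} \<and>
     (\<forall>i<n. \<forall>j<n. vs ! i \<in> set S \<longrightarrow> vs ! j \<in> set S \<longrightarrow>
        (M (n + i) < M (n + j) \<longleftrightarrow> priority S (vs ! i) < priority S (vs ! j)))"

section \<open>Territories and loads as cells of the padded line\<close>

lemma line_dist_padded: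
  assumes "i < n" "j < n"
  shows "line_dist (n + i) (n + j) = line_dist i j"
    "line_dist (n + i) (n + j) < line_dist (n + i) 0"
    "line_dist (n + i) (n + j) < line_dist (n + i) (3 * n - 1)"
  using assms by (auto simp: line_dist_def)

lemma in_cell_iff:
  assumes "represents M S" "distinct S" "t < length S" "S ! t = vs ! p" "p < n" "i < n"
    "set S \<subseteq> {..<n}"
  shows "n + i \<in> cell M (n + p) \<longleftrightarrow> vs ! i \<in> territory {..<n} E S t"
proof -
  have *: "beats M (n + p) (n + q) (n + i) \<longleftrightarrow>
      graph_dist {..<n} E (vs ! i) (S ! t) < graph_dist {..<n} E (vs ! i) (S ! j) \<or>
      graph_dist {..<n} E (vs ! i) (S ! t) = graph_dist {..<n} E (vs ! i) (S ! j) \<and> t < j"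
    if "j < length S" "S ! j = vs ! q" "q < n" for j q
  proof -
    have "M (n + p) < M (n + q) \<longleftrightarrow> priority S (S ! t) < priority S (S ! j)"
    proof -
      have "vs ! p \<in> set S" "vs ! q \<in> set S" using assms(3,4) that nth_mem by metis+
      then show ?thesis using assms(1,4,5) that unfolding represents_def by simp
    qed
    moreover have "priority S (S ! t) = Suc t" "priority S (S ! j) = Suc j"
      using assms(2,3) that(1) by simp_all
    ultimately have "M (n + p) < M (n + q) \<longleftrightarrow> t < j" by simp
    then show ?thesis unfolding beats_def using assms that
      by (simp add: line_dist_padded graph_dist_path)
  qed
  have "n + i \<in> cell M (n + p) \<longleftrightarrow>
      (\<forall>q<n. vs ! q \<in> set S \<longrightarrow> q \<noteq> p \<longrightarrow> beats M (n + p) (n + q) (n + i))"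
  proof -
    have "sources M = {0, 3 * n - 1} \<union> (\<lambda>i. n + i) ` {i. i < n \<and> vs ! i \<in> set S}"
      using assms(1) unfolding represents_def by blast
    \<comment> \<open>Path vertices are strictly closer to each other than to a sentinel, so the
      sentinels impose no condition here.\<close>
    moreover have "beats M (n + p) 0 (n + i)" "beats M (n + p) (3 * n - 1) (n + i)"
      using line_dist_padded[of i p] assms(5,6) unfolding beats_def by auto
    ultimately show ?thesis unfolding cell_def by auto
  qed
  also have "\<dots> \<longleftrightarrow> (\<forall>j<length S. j \<noteq> t \<longrightarrow>
      graph_dist {..<n} E (vs ! i) (S ! t) < graph_dist {..<n} E (vs ! i) (S ! j) \<or>
      graph_dist {..<n} E (vs ! i) (S ! t) = graph_dist {..<n} E (vs ! i) (S ! j) \<and> t < j)"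
    (is "?l \<longleftrightarrow> ?r")
  proof
    assume ?l
    show ?r
    proof (intro allI impI)
      fix j assume j: "j < length S" "j \<noteq> t"
      then have "S ! j < n" using assms(7) nth_mem by blast
      then obtain q where q: "q < n" "S ! j = vs ! q" using ex_position by blast
      moreover have "q \<noteq> p" using q j assms by (metis nth_eq_iff_index_eq)
      moreover have "vs ! q \<in> set S" using q j by (metis nth_mem)
      ultimately show "graph_dist {..<n} E (vs ! i) (S ! t) < graph_dist {..<n} E (vs ! i) (S ! j) \<or>
        graph_dist {..<n} E (vs ! i) (S ! t) = graph_dist {..<n} E (vs ! i) (S ! j) \<and> t < j"
        using * j \<open>?l\<close> by blast
    qed
  next
    assume ?r
    show ?l
    proof (intro allI impI)
      fix q assume q: "q < n" "vs ! q \<in> set S" "q \<noteq> p"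
      then obtain j where j: "j < length S" "S ! j = vs ! q" by (auto simp: in_set_conv_nth)
      moreover have "j \<noteq> t" using q j assms by auto
      ultimately show "beats M (n + p) (n + q) (n + i)"
        using * q \<open>?r\<close> by blast
    qed
  qed
  also have "\<dots> \<longleftrightarrow> vs ! i \<in> territory {..<n} E S t"
    using in_territory_iff[OF assms(3), of "vs ! i"] assms(6) by auto
  finally show ?thesis .
qed

lemma cell_load_real:
  "cell_load (padded_weight \<pi>) (3 * n) M s = (\<Sum>i | i < n \<and> n + i \<in> cell M s. \<pi> (vs ! i))"
proof -
  have "cell_load (padded_weight \<pi>) (3 * n) M s =
      sum (padded_weight \<pi>) ((\<lambda>i. n + i) ` {i. i < n \<and> n + i \<in> cell M s})"
    unfolding cell_load_def
  proof (rule sum.mono_neutral_right)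
    show "\<forall>x\<in>{x. x < 3 * n \<and> x \<in> cell M s} - (\<lambda>i. n + i) ` {i. i < n \<and> n + i \<in> cell M s}.
      padded_weight \<pi> x = 0"
    proof
      fix x assume x: "x \<in> {x. x < 3 * n \<and> x \<in> cell M s} - (\<lambda>i. n + i) ` {i. i < n \<and> n + i \<in> cell M s}"
      have "\<not> (n \<le> x \<and> x < 2 * n)"
      proof
        assume "n \<le> x \<and> x < 2 * n"
        then have "x - n < n" "n + (x - n) = x" by auto
        with x show False by (metis (mono_tags, lifting) DiffE image_eqI mem_Collect_eq)
      qed
      then show "padded_weight \<pi> x = 0" by (auto simp: padded_weight_def)
    qed
  qed auto
  also have "\<dots> = (\<Sum>i | i < n \<and> n + i \<in> cell M s. \<pi> (vs ! i))"
    by (simp add: sum.reindex padded_weight_def)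
  finally show ?thesis .
qed

lemma load_eq_cell_load:
  assumes "represents M S" "distinct S" "t < length S" "S ! t = vs ! p" "p < n" "set S \<subseteq> {..<n}"
  shows "load {..<n} E \<pi> S t = cell_load (padded_weight \<pi>) (3 * n) M (n + p)"
proof -
  have "territory {..<n} E S t = (!) vs ` {i. i < n \<and> n + i \<in> cell M (n + p)}"
    using in_cell_iff[OF assms(1-5) _ assms(6)] ex_position
    by (auto simp: image_iff) (metis (no_types, lifting) in_territory_iff[OF assms(3)] lessThan_iff)
  then show ?thesis
    unfolding load_def cell_load_real by (simp add: sum.reindex inj_on_def)
qed

text \<open>A nonempty list has a source on the path, which is strictly closer to every path vertex
  than either sentinel. The lists to be evaluated, \<open>S @ [v]\<close>, are never empty.\<close>

lemma sentinel_load: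
  assumes "represents M S" "S \<noteq> []" "set S \<subseteq> {..<n}" "s = 0 \<or> s = 3 * n - 1"
  shows "cell_load (padded_weight \<pi>) (3 * n) M s = 0"
proof -
  obtain p where p: "p < n" "vs ! p \<in> set S"
    using assms(2,3) ex_position by (metis hd_in_set lessThan_iff subsetD)
  then have src: "n + p \<in> sources M" "n + p \<noteq> s" using assms(1,4) unfolding represents_def by auto
  have "n + i \<notin> cell M s" if "i < n" for i
  proof -
    have "\<not> beats M s (n + p) (n + i)"
      using line_dist_padded[OF that p(1)] assms(4) unfolding beats_def by auto
    then show ?thesis using src unfolding cell_def by auto
  qed
  then show ?thesis unfolding cell_load_real by (auto intro!: sum.neutral)
qed

text \<open>The sentinels add only the value 0 to the set of loads, and the maximum absorbs it
  because loads are nonnegative.\<close>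

lemma max_load_eq:
  assumes "represents M S" "distinct S" "S \<noteq> []" "set S \<subseteq> {..<n}" "\<And>v. v < n \<Longrightarrow> 0 \<le> \<pi> v"
  shows "max_load {..<n} E \<pi> S = Max (cell_load (padded_weight \<pi>) (3 * n) M ` sources M)"
proof -
  let ?c = "cell_load (padded_weight \<pi>) (3 * n) M"
  have "?c ` sources M = insert 0 (load {..<n} E \<pi> S ` {..<length S})"
  proof (intro equalityI subsetI)
    fix y assume "y \<in> ?c ` sources M"
    then consider "y = ?c 0 \<or> y = ?c (3 * n - 1)" | i where "i < n" "vs ! i \<in> set S" "y = ?c (n + i)"
      using assms(1) unfolding represents_def by auto
    then show "y \<in> insert 0 (load {..<n} E \<pi> S ` {..<length S})"
    proof cases
      case 1
      then show ?thesis using sentinel_load[OF assms(1,3,4)] by auto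
    next
      case 2
      then obtain t where "t < length S" "S ! t = vs ! i" by (auto simp: in_set_conv_nth)
      then have "y = load {..<n} E \<pi> S t" using load_eq_cell_load 2 assms by simp
      then show ?thesis using \<open>t < length S\<close> by auto
    qed
  next
    fix y assume "y \<in> insert 0 (load {..<n} E \<pi> S ` {..<length S})"
    then consider "y = 0" | t where "t < length S" "y = load {..<n} E \<pi> S t" by auto
    then show "y \<in> ?c ` sources M"
    proof cases
      case 1
      moreover have "0 \<in> sources M" using assms(1) unfolding represents_def by blast
      ultimately show ?thesis using sentinel_load[OF assms(1,3,4), of 0] by (metis imageI)
    next
      case 2
      then have "S ! t < n" using assms(4) nth_mem by blast
      then obtain p where p: "p < n" "S ! t = vs ! p" using ex_position by blast
      then have "y = ?c (n + p)" using load_eq_cell_load 2 assms by simp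
      moreover have "vs ! p \<in> set S" using p 2 nth_mem by metis
      then have "n + p \<in> sources M" using p assms(1) unfolding represents_def by blast
      ultimately show ?thesis by blast
    qed
  qed
  moreover have "0 \<le> Max (load {..<n} E \<pi> S ` {..<length S})"
  proof -
    have "0 \<le> load {..<n} E \<pi> S 0"
      unfolding load_def by (intro sum_nonneg assms(5)) (auto simp: territory_def)
    also have "\<dots> \<le> Max (load {..<n} E \<pi> S ` {..<length S})" using assms(3) by (intro Max_ge) auto
    finally show ?thesis .
  qed
  moreover have "load {..<n} E \<pi> S ` {..<length S} \<noteq> {}" using assms(3) by auto
  ultimately show ?thesis unfolding max_load_def by (simp del: image_is_empty)
qed

lemma sources_padded_mark:
  "sources (padded_mark S) = {0, 3 * n - 1} \<union> (\<lambda>i. n + i) ` {i. i < n \<and> vs ! i \<in> set S}"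
proof (intro equalityI subsetI)
  fix x assume x: "x \<in> sources (padded_mark S)"
  show "x \<in> {0, 3 * n - 1} \<union> (\<lambda>i. n + i) ` {i. i < n \<and> vs ! i \<in> set S}"
  proof (cases "x = 0 \<or> x = 3 * n - 1")
    case False
    with x have "x - n < n" "x = n + (x - n)" "vs ! (x - n) \<in> set S"
      by (auto simp: sources_def padded_mark_def split: if_splits)
    then show ?thesis by blast
  qed auto
qed (use n_pos in \<open>auto simp: sources_def padded_mark_def\<close>)

lemma padded_mark_real [simp]: "i < n \<Longrightarrow> padded_mark S (n + i) = priority S (vs ! i)"
  by (auto simp: padded_mark_def)

text \<open>\<open>length S + 3\<close> is the first value above the two sentinel marks. Like the
  true priority \<open>length S + 1\<close>, it exceeds all priorities in \<open>S\<close>, so the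
  order agrees.\<close>

lemma represents_insert:
  assumes "distinct S" "k < n" "vs ! k \<notin> set S"
  shows "represents ((padded_mark S)(n + k := length S + 3)) (S @ [vs ! k])"
  unfolding represents_def
proof (intro conjI allI impI)
  have "sources ((padded_mark S)(n + k := length S + 3)) = insert (n + k) (sources (padded_mark S))"
    by (auto simp: sources_def)
  then show "sources ((padded_mark S)(n + k := length S + 3)) =
      {0, 3 * n - 1} \<union> (\<lambda>i. n + i) ` {i. i < n \<and> vs ! i \<in> set (S @ [vs ! k])}"
    unfolding sources_padded_mark using assms(2) by auto
  have d: "distinct (S @ [vs ! k])" using assms by simp
  have *: "priority (S @ [vs ! k]) (vs ! k) = Suc (length S)"
    using priority_nth[OF d, of "length S"] by simp
  fix i j assume ij: "i < n" "j < n" "vs ! i \<in> set (S @ [vs ! k])" "vs ! j \<in> set (S @ [vs ! k])"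
  have "priority S v < Suc (length S)" "priority S v < length S + 3"
      "\<not> Suc (length S) < priority S v" "\<not> length S + 3 < priority S v" for v
    using priority_le[OF assms(1), of v] by auto
  then show "((padded_mark S)(n + k := length S + 3)) (n + i) < ((padded_mark S)(n + k := length S + 3)) (n + j) \<longleftrightarrow>
      priority (S @ [vs ! k]) (vs ! i) < priority (S @ [vs ! k]) (vs ! j)"
    using ij assms(2) priority_append[OF d, of "vs ! i"] priority_append[OF d, of "vs ! j"] *
    by (cases "i = k"; cases "j = k") (simp_all del: priority_pos_iff)
qed

lemma weighted_line_padded:
  assumes "distinct S" "\<And>v. v < n \<Longrightarrow> 0 \<le> \<pi> v"
  shows "weighted_line (padded_weight \<pi>) (3 * n) (padded_mark S)"
proof
  show "0 \<le> padded_weight \<pi> x" for x using assms(2) by (auto simp: padded_weight_def)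
  show "sources (padded_mark S) \<subseteq> {..<3 * n}" unfolding sources_padded_mark using n_pos by auto
  show "inj_on (padded_mark S) (sources (padded_mark S))"
  proof (rule inj_onI)
    fix x y assume x: "x \<in> sources (padded_mark S)" and y: "y \<in> sources (padded_mark S)"
      and e: "padded_mark S x = padded_mark S y"
    have le: "priority S v \<le> length S" for v using priority_le[OF assms(1)] .
    have le': "priority S v \<noteq> Suc (length S)" "priority S v \<noteq> Suc (Suc (length S))"
       "priority S v \<noteq> length S + 1"  "priority S v \<noteq> length S + 2" for v using le[of v] by auto
    have inj: "i = j" if "i < n" "j < n" "vs ! i \<in> set S" "priority S (vs ! i) = priority S (vs ! j)" for i j
      using priority_inj[OF assms(1) that(3,4)] that by simp
    have sent: "padded_mark S 0 = length S + 1" "padded_mark S (3 * n - 1) = length S + 2"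
      using n_pos by (auto simp: padded_mark_def)
    show "x = y" using x y e inj le' le'[symmetric] unfolding sources_padded_mark
      by (elim UnE insertE imageE emptyE; clarsimp simp: sent simp del: One_nat_def)
         (auto simp: sent)
  qed
qed

lemma max_load_append:
  assumes "distinct S" "set S \<subseteq> {..<n}" "\<And>v. v < n \<Longrightarrow> 0 \<le> \<pi> v" "k < n" "vs ! k \<notin> set S"
  shows "max_load {..<n} E \<pi> (S @ [vs ! k]) =
    weighted_line.load_with (padded_weight \<pi>) (3 * n) (padded_mark S) (length S + 3) (n + k)"
proof -
  have "sources ((padded_mark S)(n + k := length S + 3)) = insert (n + k) (sources (padded_mark S))"
    by (auto simp: sources_def)
  then show ?thesis
    using max_load_eq[OF represents_insert[OF assms(1,4,5)], of \<pi>] assms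
      weighted_line.load_with_def[OF weighted_line_padded[OF assms(1)], of \<pi>] by simp
qed

text \<open>An inner vertex has two neighbours. The condition is \<open>< 2\<close> rather than
  \<open>= 1\<close> so that the only vertex of a one-vertex path, of degree 0, also counts as an
  endpoint.\<close>

lemma degree_less_2_cases:
  assumes "adjacency_lists n E adj" "i < n" "length (adj ! (vs ! i)) < 2"
  shows "i = 0 \<or> i = n - 1"
proof (rule ccontr)
  assume "\<not> (i = 0 \<or> i = n - 1)"
  then have i: "0 < i" "Suc i < n" using assms(2) by auto
  then have "vs ! (i - 1) \<in> set (adj ! (vs ! i))" "vs ! Suc i \<in> set (adj ! (vs ! i))"
    using assms(1) edge_iff[of "i - 1" i] edge_iff[of "Suc i" i] by (auto simp: adjacency_lists_def)
  moreover have "vs ! (i - 1) \<noteq> vs ! Suc i" using i by simp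
  ultimately have "2 \<le> card (set (adj ! (vs ! i)))"
    by (metis List.finite_set card_2_iff card_mono empty_subsetI insert_subset)
  then show False using assms(3) card_length[of "adj ! (vs ! i)"] by linarith
qed

lemma degree_first:
  assumes "adjacency_lists n E adj"
  shows "length (adj ! (vs ! 0)) < 2"
proof -
  have "u = vs ! 1" if "{u, vs ! 0} \<in> E" for u
  proof -
    obtain i where "{u, vs ! 0} = {vs ! i, vs ! Suc i}" "Suc i < n" using \<open>_ \<in> E\<close> unfolding E_eq by auto
    then show ?thesis using n_pos by (auto simp: doubleton_eq_iff)
  qed
  then have "set (adj ! (vs ! 0)) \<subseteq> {vs ! 1}"
    using assms n_pos by (auto simp: adjacency_lists_def)
  then have "card (set (adj ! (vs ! 0))) \<le> 1" using card_mono[of "{vs ! 1}"] by simp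
  moreover have "distinct (adj ! (vs ! 0))" using assms n_pos by (simp add: adjacency_lists_def)
  ultimately show ?thesis using distinct_card by fastforce
qed

end

text \<open>Which endpoint is found depends on the numbering of the vertices; reversal makes it the
  first vertex.\<close>

lemma path_graph_rev:
  assumes "path_graph n E vs"
  shows "path_graph n E (rev vs)"
proof -
  interpret path_graph n E vs by fact
  have "{{rev vs ! i, rev vs ! Suc i} | i. Suc i < length (rev vs)} =
      {{vs ! i, vs ! Suc i} | i. Suc i < length vs}"
  proof (intro equalityI subsetI)
    fix e assume "e \<in> {{rev vs ! i, rev vs ! Suc i} | i. Suc i < length (rev vs)}"
    then obtain i where "e = {rev vs ! i, rev vs ! Suc i}" "Suc i < n" by auto
    then have "e = {vs ! (n - Suc (Suc i)), vs ! Suc (n - Suc (Suc i))}" "Suc (n - Suc (Suc i)) < n"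
      by (auto simp: rev_nth insert_commute Suc_diff_Suc)
    then show "e \<in> {{vs ! i, vs ! Suc i} | i. Suc i < length vs}" by auto
  next
    fix e assume "e \<in> {{vs ! i, vs ! Suc i} | i. Suc i < length vs}"
    then obtain i where "e = {vs ! i, vs ! Suc i}" "Suc i < n" by auto
    then have "e = {rev vs ! (n - Suc (Suc i)), rev vs ! Suc (n - Suc (Suc i))}" "Suc (n - Suc (Suc i)) < n"
      by (auto simp: rev_nth insert_commute Suc_diff_Suc)
    then show "e \<in> {{rev vs ! i, rev vs ! Suc i} | i. Suc i < length (rev vs)}" by auto
  qed
  then show ?thesis
    using n_pos distinct_vs set_vs E_eq by unfold_locales simp_all
qed

section \<open>The program\<close>

text \<open>
  Register 21 and real register 0 are never written and hold 0.  Registers 2 to 12 hold constants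
  and base addresses, fixed by \<open>init_code\<close> and listed in \<open>constants\<close> below.  Word memory:
  input below \<open>6 * n\<close>, priorities by vertex at \<open>6 * n\<close>, marks by position at \<open>7 * n\<close>, vertices
  by position at \<open>10 * n\<close>, next source on the right at \<open>13 * n\<close>.  Real memory: input below
  \<open>n\<close>, weights by position at \<open>7 * n\<close>, prefix sum up to the right border of the next source at
  \<open>10 * n\<close>, maximal load beyond that source at \<open>13 * n\<close>, prefix sums at \<open>16 * n\<close>.
\<close>

lemma nth_concat_take:
  assumes "v < length xss" "j < length (xss ! v)"
  shows "length (concat (take v xss)) + j < length (concat xss)"
    and "concat xss ! (length (concat (take v xss)) + j) = xss ! v ! j"
proof -
  have "concat xss = concat (take v xss) @ xss ! v @ concat (drop (Suc v) xss)"
    using id_take_nth_drop[OF assms(1)] by (metis concat.simps(2) concat_append)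
  then show "length (concat (take v xss)) + j < length (concat xss)"
    and "concat xss ! (length (concat (take v xss)) + j) = xss ! v ! j"
    using assms(2) by (auto simp: nth_append)
qed

fun block :: "instr list \<Rightarrow> com" where
  "block [] = Skip"
| "block (i # is) = Basic i Then block is"

definition init_code :: com where
  "init_code = block
    [Const 2 1, Load 3 21, Load 4 2,
     Add 10 3 3, Add 10 10 3,
     Add 5 10 10, Add 6 5 3, Add 7 6 10, Add 8 7 10, Add 9 8 10,
     Add 11 4 2, Add 11 11 2, Add 12 11 2, Add 12 12 3]"

definition mark_body :: com where
  "mark_body = block
    [Add 14 13 2, Add 14 14 2, Load 15 14, Add 15 15 5, Add 13 13 2, Store 15 13]"

text \<open>The degree is a difference of consecutive offsets. Register 15 keeps the first of them,
  from which \<open>traverse_init\<close> continues.\<close>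

definition degree_code :: com where
  "degree_code = block
    [Add 14 11 13, Load 15 14, Add 14 14 2, Load 16 14, Sub 17 16 15]"

definition endpoint_body :: com where
  "endpoint_body = Basic (Add 13 13 2) Then degree_code"

text \<open>
  The successor of an inner vertex is the sum of its two neighbours minus its predecessor.  For the
  first vertex, which has only one neighbour, register 18 (the predecessor) is loaded with whatever
  word follows that neighbour, so that the same computation works.
\<close>

definition traverse_init :: com where
  "traverse_init = block
    [Add 14 12 15, Add 14 14 2, Load 18 14, Add 19 3 21, Add 20 3 3]"

definition traverse_body :: com where
  "traverse_body = block
    [Add 14 5 13, Load 15 14, Add 14 6 19, Store 14 15,
     RLoad 11 13, RStore 14 11,
     Add 14 7 19, Store 14 13,
     Add 14 11 13, Load 15 14, Add 14 12 15, Load 15 14, Add 14 14 2, Load 16 14,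
     Add 15 15 16, Sub 15 15 18, Add 18 13 21, Add 13 15 21, Add 19 19 2]"

definition sentinel_code :: com where
  "sentinel_code = block
    [Add 14 4 2, Store 6 14, Add 14 14 2, Add 15 6 10, Sub 15 15 2, Store 15 14,
     Add 13 21 21, Add 14 9 21]"

text \<open>Each position yields two equal entries, at \<open>2 * i + 1\<close> and
  \<open>2 * i + 2\<close>, because no doubled position is odd. Entry 0 is the initial 0 of the
  memory.\<close>

definition prefix_body :: com where
  "prefix_body = block
    [Add 15 6 13, RLoad 11 15, RLoad 12 14, RAdd 11 11 12,
     Add 14 14 2, RStore 14 11, Add 14 14 2, RStore 14 11, Add 13 13 2]"

text \<open>Adding real register 0, which holds 0, serves as a move.\<close>

definition set_max :: "nat \<Rightarrow> nat \<Rightarrow> com" where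
  "set_max i j = Cond (RLess i j) (Basic (RAdd i j 0)) Skip"

definition backward_init :: com where
  "backward_init = block
    [Add 13 3 3, Sub 14 10 2, Add 15 6 14, Load 17 15,
     Add 15 9 10, Add 15 15 10, RLoad 3 15, RAdd 4 0 0]"

text \<open>Registers 13, 14 and 17 hold the position, the next source and its mark, real registers
  3 and 4 the last two arguments of \<open>right_info\<close>. Register 18 becomes the address of
  the border's prefix sum; the inner conditional adds 1 if the new source wins ties.\<close>

definition backward_body :: com where
  "backward_body = block [Sub 13 13 2, Add 15 6 13, Load 16 15] Then
    Cond (NLess 21 16)
      (Basic (Add 18 13 14) Then Cond (NLess 16 17) (Basic (Add 18 18 2)) Skip Then
       block [Add 18 18 9, RLoad 11 18, RSub 12 3 11] Then set_max 4 12 Then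
       block [RAdd 3 11 0, Add 14 13 21, Add 17 16 21])
      (block [Add 15 8 13, Store 15 14, RStore 15 4, Add 15 7 13, RStore 15 3])"

definition forward_init :: com where
  "forward_init = block
    [Add 13 3 21, Add 19 3 3, Add 14 21 21, Load 17 6, RAdd 3 0 0, RAdd 4 0 0,
     Add 15 9 10, Add 15 15 10, RLoad 5 15]"

definition max_difference :: "nat \<Rightarrow> nat \<Rightarrow> com" where
  "max_difference i j = Basic (RSub 12 i j) Then set_max 11 12"

text \<open>Computes the right-hand side of \<open>load_with_eq\<close>: real registers 8 and 9
  receive the prefix sums at \<open>a + k + 1\<close> and \<open>k + b\<close>, registers 6 and 7
  the tabulated \<open>v\<close> and \<open>t\<close>.\<close>

definition evaluate_code :: com where
  "evaluate_code =
     block [Add 15 8 13, Load 18 15, RLoad 7 15, Add 15 7 13, RLoad 6 15,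
       Add 15 14 13, Add 15 15 2, Add 15 15 9, RLoad 8 15,
       Add 15 13 18, Add 15 15 9, RLoad 9 15, RAdd 11 4 0] Then
     set_max 11 7 Then max_difference 8 3 Then max_difference 9 8 Then max_difference 6 9"

text \<open>A tie replaces the old choice. This matters for the first candidate: its load may equal
  the total weight with which real register 5 starts, and register 0 must be set
  nevertheless.\<close>

definition update_code :: com where
  "update_code = Cond (RLess 5 11) Skip (block [RAdd 5 11 0, Add 15 7 13, Load 0 15])"

definition forward_body :: com where
  "forward_body = block [Add 15 6 13, Load 16 15] Then
    Cond (NLess 21 16)
      (Basic (Add 18 14 13) Then Cond (NLess 17 16) (Basic (Add 18 18 2)) Skip Then
       block [Add 18 18 9, RLoad 11 18, RSub 12 11 3] Then set_max 4 12 Then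
       block [RAdd 3 11 0, Add 14 13 21, Add 17 16 21])
      (evaluate_code Then update_code) Then
    Basic (Add 13 13 2)"

definition balanced_vertex_code :: com where
  "balanced_vertex_code =
     init_code Then While (NLess 13 4) mark_body Then
     (Basic (Add 13 21 21) Then degree_code) Then While (NLess 2 17) endpoint_body Then
     traverse_init Then While (NLess 19 20) traverse_body Then
     sentinel_code Then While (NLess 13 10) prefix_body Then
     backward_init Then While (NLess 3 13) backward_body Then
     forward_init Then While (NLess 13 19) forward_body"

lemma sem_set_max:
  assumes "rreg s 0 = 0"
  shows "rreg (sem (set_max i j) s) = (rreg s)(i := max (rreg s i) (rreg s j))"
    and "nreg (sem (set_max i j) s) = nreg s" "nmem (sem (set_max i j) s) = nmem s"
    and "rmem (sem (set_max i j) s) = rmem s"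
  using assms by (auto simp: set_max_def max_def)

lemma sem_max_difference:
  assumes "rreg s 0 = 0"
  shows "rreg (sem (max_difference i j) s) =
      (rreg s)(12 := rreg s i - rreg s j, 11 := max (rreg s 11) (rreg s i - rreg s j))"
    and "nreg (sem (max_difference i j) s) = nreg s" "nmem (sem (max_difference i j) s) = nmem s"
    and "rmem (sem (max_difference i j) s) = rmem s"
  using assms by (simp_all add: max_difference_def sem_set_max)

section \<open>Correctness of the program\<close>

locale path_input = path_graph +
  fixes adj :: "nat list list" and \<pi> :: "nat \<Rightarrow> real" and S :: "nat list"
  assumes adj: "adjacency_lists n E adj"
    and distinct_S: "distinct S"
    and set_S: "set S \<subset> {..<n}"
    and cost_nonneg: "\<And>v. v < n \<Longrightarrow> 0 \<le> \<pi> v"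
    and first_vertex: "vs ! 0 = (LEAST v. length (adj ! v) < 2)"
begin

abbreviation "p \<equiv> length S"
abbreviation "input \<equiv> nmem (input_state n adj \<pi> S)"
abbreviation "costs \<equiv> rmem (input_state n adj \<pi> S)"
abbreviation "neighbours v \<equiv> adj ! v"

section \<open>Contents of the input memory\<close>

definition offset :: "nat \<Rightarrow> nat" where
  "offset v = length (concat (take v adj))"

lemma length_adj [simp]: "length adj = n"
  using adj by (simp add: adjacency_lists_def)

lemma p_less: "p < n"
  using distinct_card[OF distinct_S] psubset_card_mono[OF _ set_S] by simp

lemma S_less [simp]: "i < p \<Longrightarrow> S ! i < n"
  using set_S nth_mem by blast

lemma S_not_ge [simp]: "i < p \<Longrightarrow> \<not> n \<le> S ! i"
  by (simp add: not_le)

lemma vs_not_ge [simp]: "i < n \<Longrightarrow> \<not> n \<le> vs ! i"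
  by (simp add: not_le)

lemma set_neighbours:
  assumes "i < n"
  shows "set (neighbours (vs ! i)) = (!) vs ` {j. j < n \<and> (j = Suc i \<or> i = Suc j)}"
proof -
  have "u < n" if "{u, vs ! i} \<in> E" for u
    using that unfolding E_eq by (auto simp: doubleton_eq_iff)
  then have "{u, vs ! i} \<in> E \<longleftrightarrow> (\<exists>j<n. u = vs ! j \<and> (j = Suc i \<or> i = Suc j))" for u
    using edge_iff[OF _ assms] ex_position[of u] by metis
  moreover have "set (neighbours (vs ! i)) = {u. {u, vs ! i} \<in> E}"
    using adj assms by (simp add: adjacency_lists_def)
  ultimately show ?thesis by blast
qed

lemma distinct_neighbours: "v < n \<Longrightarrow> distinct (neighbours v)"
  using adj by (simp add: adjacency_lists_def)

lemma length_neighbours: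
  assumes "i < n"
  shows "length (neighbours (vs ! i)) = card {j. j < n \<and> (j = Suc i \<or> i = Suc j)}"
proof -
  have "inj_on ((!) vs) {j. j < n \<and> (j = Suc i \<or> i = Suc j)}" by (auto simp: inj_on_def)
  then show ?thesis
    using distinct_card[OF distinct_neighbours] set_neighbours[OF assms] assms
    by (metis card_image vs_less)
qed

lemma length_neighbours_first: "length (neighbours (vs ! 0)) < 2"
  using degree_first[OF adj] .

text \<open>Minimality of \<open>vs ! 0\<close> makes the search for an endpoint take exactly
  \<open>vs ! 0\<close> rounds.\<close>

lemma length_neighbours_before:
  assumes "v < vs ! 0"
  shows "1 < length (neighbours v)"
  using not_less_Least[of v "\<lambda>v. length (neighbours v) < 2"] assms first_vertex by simp

lemma length_neighbours_le: "v < n \<Longrightarrow> length (neighbours v) \<le> 2"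
proof -
  assume "v < n"
  then obtain i where i: "i < n" "v = vs ! i" using ex_position by blast
  have "{j. j < n \<and> (j = Suc i \<or> i = Suc j)} \<subseteq> {Suc i, i - 1}" by auto
  from card_mono[OF _ this] have "length (neighbours v) \<le> card {Suc i, i - 1}"
    using length_neighbours i by simp
  also have "\<dots> \<le> 2" by (simp add: card_insert_le_m1)
  finally show ?thesis .
qed

lemma offset_Suc: "v < n \<Longrightarrow> offset (Suc v) = offset v + length (neighbours v)"
  unfolding offset_def using take_Suc_conv_app_nth[of v adj] by (simp del: length_concat)

lemma offset_le: "v \<le> n \<Longrightarrow> offset v \<le> 2 * v"
proof (induction v)
  case (Suc v)
  then show ?case using offset_Suc[of v] length_neighbours_le[of v] by simp
qed (simp add: offset_def)

text \<open>By \<open>p < n\<close> and degrees at most 2 there are at most \<open>4 * n + 2\<close>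
  words; \<open>6 * n\<close> covers this for every positive \<open>n\<close>.\<close>

lemma length_input: "length (input_words n adj S) \<le> 6 * n"
  using offset_le[of n] p_less n_pos by (simp add: input_words_def offset_def del: length_concat upt_Suc)

lemma input_header: "input 0 = n" "input (Suc 0) = p"
  by (simp_all add: input_state_def input_words_def del: upt_Suc length_concat)

lemma input_S: "i < p \<Longrightarrow> input (2 + i) = S ! i"
  by (simp add: input_state_def input_words_def nth_append del: upt_Suc length_concat)

lemma input_offset: "v \<le> n \<Longrightarrow> input (2 + p + v) = offset v"
  by (simp add: input_state_def input_words_def nth_append offset_def del: upt_Suc length_concat)

lemma input_neighbour:
  assumes "v < n" "j < length (neighbours v)"
  shows "input (3 + p + n + offset v + j) = neighbours v ! j"
  using nth_concat_take[of v adj j] assms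
  by (simp add: input_state_def input_words_def nth_append offset_def del: upt_Suc length_concat)

lemma input_beyond: "6 * n \<le> a \<Longrightarrow> input a = 0"
  using length_input by (simp add: input_state_def)

lemma costs_eq: "v < n \<Longrightarrow> costs v = \<pi> v"
  by (simp add: input_state_def)

lemma costs_beyond: "n \<le> a \<Longrightarrow> costs a = 0"
  by (simp add: input_state_def)

abbreviation "neighbour_sum v \<equiv>
  input (3 + p + n + offset v) + input (3 + p + n + offset v + 1)"

lemma second_vertex:
  assumes "1 < n"
  shows "neighbour_sum (vs ! 0) - input (3 + p + n + offset (vs ! 0) + 1) = vs ! 1"
proof -
  have "{j. j < n \<and> (j = Suc 0 \<or> 0 = Suc j)} = {1}" using assms by auto
  then have "length (neighbours (vs ! 0)) = 1" "set (neighbours (vs ! 0)) = {vs ! 1}"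
    using length_neighbours[OF n_pos] set_neighbours[OF n_pos] by auto
  then have "neighbours (vs ! 0) ! 0 = vs ! 1"
    by (metis less_one nth_mem singletonD)
  then show ?thesis using input_neighbour[of "vs ! 0" 0] \<open>length _ = 1\<close> n_pos by simp
qed

text \<open>The neighbours may be listed in either order, but their sum does not depend on it. The
  truncated subtraction is exact because the predecessor is one of the summands.\<close>

lemma next_vertex:
  assumes "Suc (Suc i) < n"
  shows "neighbour_sum (vs ! Suc i) - vs ! i = vs ! Suc (Suc i)"
proof -
  let ?xs = "neighbours (vs ! Suc i)"
  have "{j. j < n \<and> (j = Suc (Suc i) \<or> Suc i = Suc j)} = {i, Suc (Suc i)}" using assms by auto
  then have len: "length ?xs = 2" and set: "set ?xs = {vs ! i, vs ! Suc (Suc i)}"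
    using length_neighbours[of "Suc i"] set_neighbours[of "Suc i"] assms by auto
  then obtain x y where xy: "?xs = [x, y]"
    by (metis (no_types) One_nat_def Suc_1 length_0_conv length_Suc_conv)
  then have "x + y = vs ! i + vs ! Suc (Suc i)"
    using set distinct_neighbours[of "vs ! Suc i"] assms by (auto simp: doubleton_eq_iff)
  moreover have "neighbour_sum (vs ! Suc i) = x + y"
    using input_neighbour[of "vs ! Suc i" 0] input_neighbour[of "vs ! Suc i" 1] assms xy by simp
  ultimately show ?thesis by simp
qed

section \<open>Marking the sources\<close>

definition constants :: "ram \<Rightarrow> bool" where
  "constants s \<longleftrightarrow> nreg s 21 = 0 \<and> nreg s 2 = 1 \<and> nreg s 3 = n \<and> nreg s 4 = p \<and>
     nreg s 5 = 6 * n \<and> nreg s 6 = 7 * n \<and> nreg s 7 = 10 * n \<and> nreg s 8 = 13 * n \<and>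
     nreg s 9 = 16 * n \<and> nreg s 10 = 3 * n \<and> nreg s 11 = 2 + p \<and> nreg s 12 = 3 + p + n \<and>
     rreg s 0 = 0"

text \<open>The zeros from \<open>7 * n\<close> on are tracked because the padding positions keep
  them as their marks.\<close>

definition mark_inv :: "nat \<Rightarrow> ram \<Rightarrow> bool" where
  "mark_inv i s \<longleftrightarrow> constants s \<and> nreg s 13 = i \<and> rmem s = costs \<and>
     (\<forall>a<6 * n. nmem s a = input a) \<and> (\<forall>a\<ge>7 * n. nmem s a = 0) \<and>
     (\<forall>j<i. nmem s (6 * n + S ! j) = Suc j) \<and>
     (\<forall>v<n. v \<notin> set (take i S) \<longrightarrow> nmem s (6 * n + v) = 0)"

lemma init_triple:
  "triple (\<lambda>s. s = input_state n adj \<pi> S) init_code (code_length init_code) (mark_inv 0)"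
proof (rule triple_loop_free)
  show "loop_free init_code" by (simp add: init_code_def)
  fix s assume s: "s = input_state n adj \<pi> S"
  have regs: "nreg (input_state n adj \<pi> S) = (\<lambda>_. 0)" "rreg (input_state n adj \<pi> S) = (\<lambda>_. 0)"
    by (simp_all add: input_state_def)
  show "mark_inv 0 (sem init_code s)"
    unfolding s
    by (simp add: init_code_def mark_inv_def constants_def regs input_header input_beyond)
qed

lemma mark_step:
  assumes "i < p" "mark_inv i s"
  shows "holds (NLess 13 4) s \<and> mark_inv (Suc i) (sem mark_body s)"
proof
  note s = assms(2)[unfolded mark_inv_def constants_def]
  let ?t = "sem mark_body s"
  show "holds (NLess 13 4) s" using s assms(1) by simp
  have "nmem s (Suc (Suc i)) = S ! i"
    using s assms(1) p_less input_S[OF assms(1)] n_pos by simp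
  moreover have "S ! j \<noteq> S ! i" if "j < i" for j
    using that assms(1) distinct_S by (simp add: nth_eq_iff_index_eq)
  moreover have "S ! i < n" using assms(1) by simp
  moreover from calculation(1)
  have t: "nreg ?t = (nreg s)(14 := 2 + i, 15 := 6 * n + S ! i, 13 := Suc i)"
    "nmem ?t = (nmem s)(6 * n + S ! i := Suc i)" "rmem ?t = rmem s" "rreg ?t = rreg s"
    by (auto simp: mark_body_def s fun_eq_iff)
  ultimately show "mark_inv (Suc i) ?t"
    unfolding mark_inv_def constants_def t
    using assms(1) by (auto simp: s take_Suc_conv_app_nth less_Suc_eq)
qed

definition marked :: "ram \<Rightarrow> bool" where
  "marked s \<longleftrightarrow> constants s \<and> rmem s = costs \<and>
     (\<forall>a<6 * n. nmem s a = input a) \<and> (\<forall>a\<ge>7 * n. nmem s a = 0) \<and>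
     (\<forall>v<n. nmem s (6 * n + v) = priority S v)"

lemma mark_inv_imp_marked:
  assumes "mark_inv p s"
  shows "marked s"
proof -
  have "nmem s (6 * n + v) = priority S v" if "v < n" for v
  proof (cases "v \<in> set S")
    case True
    then obtain j where "j < p" "v = S ! j" by (auto simp: in_set_conv_nth)
    then show ?thesis using assms distinct_S by (auto simp: mark_inv_def)
  next
    case False
    then have "priority S v = 0" by simp
    then show ?thesis using assms that False unfolding mark_inv_def by simp
  qed
  then show ?thesis using assms unfolding mark_inv_def marked_def by auto
qed

section \<open>Search for an endpoint\<close>

definition endpoint_inv :: "nat \<Rightarrow> ram \<Rightarrow> bool" where
  "endpoint_inv i s \<longleftrightarrow> marked s \<and> nreg s 13 = i \<and> nreg s 15 = offset i \<and>
     nreg s 17 = length (neighbours i)"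

lemma degree_code_inv:
  assumes "marked s" "nreg s 13 = i" "i < n"
  shows "endpoint_inv i (sem degree_code s)"
proof -
  note s = assms(1)[unfolded marked_def constants_def]
  let ?t = "sem degree_code s"
  have r: "nreg s 2 = 1" "nreg s 11 = 2 + p" using s by blast+
  have mem: "\<forall>a<6 * n. nmem s a = input a" using s by blast
  have a: "2 + p + Suc i < 6 * n" "2 + p + i < 6 * n" using assms(3) p_less by auto
  have "nmem s (2 + p + i) = offset i" "nmem s (2 + p + Suc i) = offset (Suc i)"
    using mem[rule_format, OF a(1)] mem[rule_format, OF a(2)]
      input_offset[of i] input_offset[of "Suc i"] assms(3) by simp_all
  then have t: "nreg ?t = (nreg s)(14 := 3 + p + i, 15 := offset i, 16 := offset (Suc i),
      17 := length (neighbours i))" "nmem ?t = nmem s" "rmem ?t = rmem s" "rreg ?t = rreg s"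
    by (auto simp: degree_code_def r assms(2) offset_Suc[OF assms(3)] fun_eq_iff)
  have "constants ?t" using assms(1) unfolding marked_def constants_def t by simp
  then show ?thesis
    using assms unfolding endpoint_inv_def marked_def t by simp
qed

lemma endpoint_init_triple:
  "triple (mark_inv p) (Basic (Add 13 21 21) Then degree_code)
     (code_length (Basic (Add 13 21 21) Then degree_code)) (endpoint_inv 0)"
proof (rule triple_loop_free)
  fix s assume "mark_inv p s"
  then have "marked s" by (rule mark_inv_imp_marked)
  then have "endpoint_inv 0 (sem degree_code (sem (Basic (Add 13 21 21)) s))"
    using n_pos by (intro degree_code_inv) (auto simp: marked_def constants_def)
  then show "endpoint_inv 0 (sem (Basic (Add 13 21 21) Then degree_code) s)" by simp
qed (simp add: degree_code_def)

lemma endpoint_step: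
  assumes "i < vs ! 0" "endpoint_inv i s"
  shows "holds (NLess 2 17) s \<and> endpoint_inv (Suc i) (sem endpoint_body s)"
proof
  note s = assms(2)[unfolded endpoint_inv_def marked_def constants_def]
  have i: "Suc i < n" using assms(1) vs_less[OF n_pos] by linarith
  show "holds (NLess 2 17) s" using s length_neighbours_before[OF assms(1)] by simp
  have "endpoint_inv (Suc i) (sem degree_code (sem (Basic (Add 13 13 2)) s))"
    using s i by (intro degree_code_inv) (auto simp: marked_def constants_def)
  then show "endpoint_inv (Suc i) (sem endpoint_body s)" by (simp add: endpoint_body_def)
qed

lemma endpoint_exit: "endpoint_inv (vs ! 0) s \<Longrightarrow> \<not> holds (NLess 2 17) s"
proof -
  assume "endpoint_inv (vs ! 0) s"
  then have "nreg s 2 = 1" "nreg s 17 = length (neighbours (vs ! 0))"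
    unfolding endpoint_inv_def marked_def constants_def by blast+
  then show ?thesis using length_neighbours_first by simp
qed

section \<open>Recovery of the order along the path\<close>

definition traverse_inv :: "nat \<Rightarrow> ram \<Rightarrow> bool" where
  "traverse_inv i s \<longleftrightarrow> constants s \<and> nreg s 19 = n + i \<and> nreg s 20 = 2 * n \<and>
     (\<forall>a<6 * n. nmem s a = input a) \<and> (\<forall>v<n. nmem s (6 * n + v) = priority S v) \<and>
     (\<forall>v<n. rmem s v = \<pi> v) \<and> rmem s (16 * n) = 0 \<and>
     (i < n \<longrightarrow> nreg s 13 = vs ! i \<and>
        (Suc i < n \<longrightarrow> neighbour_sum (vs ! i) - nreg s 18 = vs ! Suc i)) \<and>
     (\<forall>x<3 * n. nmem s (7 * n + x) = (if n \<le> x \<and> x < n + i then priority S (vs ! (x - n)) else 0)) \<and>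
     (\<forall>x<3 * n. rmem s (7 * n + x) = (if n \<le> x \<and> x < n + i then \<pi> (vs ! (x - n)) else 0)) \<and>
     (\<forall>j<i. nmem s (11 * n + j) = vs ! j)"

lemma traverse_init_triple:
  "triple (endpoint_inv (vs ! 0)) traverse_init (code_length traverse_init) (traverse_inv 0)"
proof (rule triple_loop_free)
  fix s assume "endpoint_inv (vs ! 0) s"
  note s = this[unfolded endpoint_inv_def marked_def constants_def]
  let ?a = "3 + p + n + offset (vs ! 0) + 1"
  \<comment> \<open>This word need not belong to the adjacency list of \<open>vs ! 0\<close>. What
    counts is that below \<open>6 * n\<close> the memory stays unchanged, so the traversal adds and
    subtracts the same value.\<close>
  have "?a < 6 * n" using offset_le[of "vs ! 0"] vs_less[OF n_pos] p_less by linarith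
  then have "nmem s ?a = input ?a" using s by blast
  then show "traverse_inv 0 (sem traverse_init s)"
    using n_pos second_vertex
    by (simp add: s costs_eq costs_beyond traverse_inv_def constants_def traverse_init_def) auto
qed (simp add: traverse_init_def)

lemma traverse_step:
  assumes "i < n" "traverse_inv i s"
  shows "holds (NLess 19 20) s \<and> traverse_inv (Suc i) (sem traverse_body s)"
proof
  note s = assms(2)[unfolded traverse_inv_def constants_def]
  show "holds (NLess 19 20) s" using s assms(1) by simp
  let ?v = "vs ! i"
  let ?a = "3 + p + n + offset ?v"
  have "?a + 1 < 6 * n" using offset_le[of ?v] vs_less[OF assms(1)] p_less by linarith
  then have 1: "nmem s ?a = input ?a" "nmem s (?a + 1) = input (?a + 1)"
    using s by (metis add_lessD1)+
  have 2: "nmem s (2 + p + ?v) = offset ?v"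
  proof -
    have "2 + p + ?v < 6 * n" using vs_less[OF assms(1)] p_less by linarith
    then show ?thesis using s input_offset[of ?v] vs_less[OF assms(1)] by auto
  qed
  have 3: "nmem s (6 * n + ?v) = priority S ?v" "rmem s ?v = \<pi> ?v" "nreg s 13 = ?v"
    using s assms(1) by auto
  have 4: "2 + p + ?v < 6 * n" "?v < n"
    using vs_less[OF assms(1)] p_less by linarith+
  have 5: "Suc i < n \<longrightarrow> neighbour_sum ?v - nreg s 18 = vs ! Suc i"
    using s assms(1) by blast
  let ?t = "sem traverse_body s"
  have t: "nreg ?t = (nreg s)(14 := ?a + 1, 15 := neighbour_sum ?v - nreg s 18,
      16 := input (?a + 1), 18 := ?v, 13 := neighbour_sum ?v - nreg s 18, 19 := n + Suc i)"
    "nmem ?t = (nmem s)(8 * n + i := priority S ?v, 11 * n + i := ?v)"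
    "rmem ?t = (rmem s)(8 * n + i := \<pi> ?v)"
    "rreg ?t = (rreg s)(11 := \<pi> ?v)"
    using 1 2 3 4 \<open>?a + 1 < 6 * n\<close> by (auto simp: traverse_body_def s fun_eq_iff)
  show "traverse_inv (Suc i) ?t"
    unfolding traverse_inv_def constants_def t
    using assms(1) next_vertex[of i] 5 by (auto simp: s)
qed

section \<open>Sentinels and prefix sums\<close>

sublocale padded: weighted_line "padded_weight \<pi>" "3 * n" "padded_mark S"
  using weighted_line_padded[OF distinct_S cost_nonneg] .

abbreviation "mark \<equiv> padded_mark S"

definition padded_input :: "ram \<Rightarrow> bool" where
  "padded_input s \<longleftrightarrow> constants s \<and> (\<forall>x<3 * n. nmem s (7 * n + x) = mark x) \<and>
     (\<forall>i<n. nmem s (11 * n + i) = vs ! i)"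

definition prefix_inv :: "nat \<Rightarrow> ram \<Rightarrow> bool" where
  "prefix_inv i s \<longleftrightarrow> padded_input s \<and> nreg s 13 = i \<and> nreg s 14 = 16 * n + 2 * i \<and>
     (\<forall>x<3 * n. rmem s (7 * n + x) = padded_weight \<pi> x) \<and>
     (\<forall>j\<le>2 * i. rmem s (16 * n + j) = padded.D j)"

lemma sentinel_triple:
  "triple (traverse_inv n) sentinel_code (code_length sentinel_code) (prefix_inv 0)"
proof (rule triple_loop_free)
  fix s assume "traverse_inv n s"
  note s = this[unfolded traverse_inv_def constants_def]
  let ?t = "sem sentinel_code s"
  have t: "nreg ?t = (nreg s)(14 := 16 * n, 15 := 10 * n - 1, 13 := 0)"
    "nmem ?t = (nmem s)(7 * n := p + 1, 10 * n - 1 := p + 2)"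
    "rmem ?t = rmem s" "rreg ?t = rreg s"
    by (auto simp: sentinel_code_def s fun_eq_iff)
  show "prefix_inv 0 ?t"
    unfolding prefix_inv_def padded_input_def constants_def t
    using n_pos by (auto simp: s padded_mark_def padded_weight_def)
qed (simp add: sentinel_code_def)

lemma prefix_step:
  assumes "i < 3 * n" "prefix_inv i s"
  shows "holds (NLess 13 10) s \<and> prefix_inv (Suc i) (sem prefix_body s)"
proof
  note s = assms(2)[unfolded prefix_inv_def padded_input_def constants_def]
  show "holds (NLess 13 10) s" using assms(1) by (simp add: s)
  let ?t = "sem prefix_body s"
  let ?d = "padded.D (2 * i + 1)"
  have "?d = padded_weight \<pi> i + padded.D (2 * i)"
    using weight_below_odd[OF assms(1)] by simp
  moreover have "rmem s (7 * n + i) = padded_weight \<pi> i" "rmem s (16 * n + 2 * i) = padded.D (2 * i)"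
    using s assms(1) by blast+
  ultimately have t: "nreg ?t = (nreg s)(15 := 7 * n + i, 14 := 16 * n + (2 * i + 2), 13 := Suc i)"
    "rmem ?t = (rmem s)(16 * n + (2 * i + 1) := ?d, 16 * n + (2 * i + 2) := ?d)"
    "rreg ?t = (rreg s)(12 := padded.D (2 * i), 11 := ?d)" "nmem ?t = nmem s"
    by (auto simp: prefix_body_def s fun_eq_iff)
  have "rmem ?t (16 * n + j) = padded.D j" if j: "j \<le> 2 * Suc i" for j
  proof -
    have "j \<le> 2 * i \<or> j = 2 * i + 1 \<or> j = 2 * i + 2" using j by auto
    then show ?thesis
      using weight_below_even[of "padded_weight \<pi>" "3 * n" i] by (elim disjE) (simp_all add: t s)
  qed
  moreover have "rmem ?t (7 * n + x) = padded_weight \<pi> x" if "x < 3 * n" for x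
    using that by (simp add: t s)
  ultimately show "prefix_inv (Suc i) ?t"
    unfolding prefix_inv_def padded_input_def constants_def by (simp add: t s)
qed

definition prefix_done :: "ram \<Rightarrow> bool" where
  "prefix_done s \<longleftrightarrow> padded_input s \<and> (\<forall>j\<le>6 * n. rmem s (16 * n + j) = padded.D j)"

lemma prefix_read: "prefix_done s \<Longrightarrow> j \<le> 6 * n \<Longrightarrow> rmem s (j + 16 * n) = padded.D j"
  unfolding prefix_done_def by (metis add.commute)

lemma mark_read: "prefix_done s \<Longrightarrow> x < 3 * n \<Longrightarrow> nmem s (7 * n + x) = mark x"
  unfolding prefix_done_def padded_input_def by blast

lemma prefix_done_regs:
  assumes "prefix_done s"
  shows "nreg s 21 = 0" "nreg s 2 = 1" "nreg s 3 = n" "nreg s 4 = p"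
     "nreg s 5 = 6 * n" "nreg s 6 = 7 * n" "nreg s 7 = 10 * n" "nreg s 8 = 13 * n"
     "nreg s 9 = 16 * n" "nreg s 10 = 3 * n" "rreg s 0 = 0"
  using assms unfolding prefix_done_def padded_input_def constants_def by blast+

section \<open>Sweep from the right\<close>

definition right_table :: "nat \<Rightarrow> ram \<Rightarrow> bool" where
  "right_table k s \<longleftrightarrow> (\<forall>x. k \<le> x \<and> x < 2 * n \<and> mark x = 0 \<longrightarrow>
     padded.right_info x (nmem s (13 * n + x)) (rmem s (10 * n + x)) (rmem s (13 * n + x)))"

definition backward_inv :: "nat \<Rightarrow> ram \<Rightarrow> bool" where
  "backward_inv i s \<longleftrightarrow> prefix_done s \<and> nreg s 13 = 2 * n - i \<and> nreg s 17 = mark (nreg s 14) \<and>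
     padded.right_info (2 * n - i) (nreg s 14) (rreg s 3) (rreg s 4) \<and> right_table (2 * n - i) s"

lemma backward_init_triple:
  "triple (prefix_inv (3 * n)) backward_init (code_length backward_init) (backward_inv 0)"
proof (rule triple_loop_free)
  fix s assume "prefix_inv (3 * n) s"
  then have d: "prefix_done s" unfolding prefix_inv_def prefix_done_def by simp
  note r = prefix_done_regs[OF d]
  let ?t = "sem backward_init s"
  have "nmem s (7 * n + (3 * n - 1)) = mark (3 * n - 1)" "rmem s (6 * n + 16 * n) = padded.D (6 * n)"
    using mark_read[OF d, of "3 * n - 1"] prefix_read[OF d, of "6 * n"] n_pos by auto
  then have t: "nreg ?t = (nreg s)(13 := 2 * n, 14 := 3 * n - 1, 17 := mark (3 * n - 1), 15 := 22 * n)"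
    "rreg ?t = (rreg s)(3 := padded.D (6 * n), 4 := 0)" "nmem ?t = nmem s" "rmem ?t = rmem s"
    by (auto simp: backward_init_def r fun_eq_iff)
  \<comment> \<open>The line has length \<open>3 * n\<close>, so index \<open>6 * n\<close> gives
    the total weight. Starting at \<open>2 * n\<close> is enough, since from there on only the
    sentinel is a source.\<close>
  have "padded.right_info (2 * n) (3 * n - 1) (padded.D (2 * (3 * n))) 0"
    using n_pos by (intro padded.right_info_last) (auto simp: padded_mark_def)
  moreover have "prefix_done ?t"
    using d unfolding prefix_done_def padded_input_def constants_def t by simp
  ultimately show "backward_inv 0 ?t"
    unfolding backward_inv_def right_table_def by (auto simp: t)
qed (simp add: backward_init_def)

lemma backward_step:
  assumes "i < n" "backward_inv i s"
  shows "holds (NLess 3 13) s \<and> backward_inv (Suc i) (sem backward_body s)"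
proof
  note s = assms(2)[unfolded backward_inv_def]
  then have d: "prefix_done s" by blast
  note r = prefix_done_regs[OF d]
  show "holds (NLess 3 13) s" using assms(1) by (simp add: s r)
  let ?t = "sem backward_body s"
  define k b where "k = 2 * n - Suc i" and "b = nreg s 14"
  have k: "2 * n - i = Suc k" "k < 2 * n" "k < 3 * n" using assms(1) by (auto simp: k_def)
  have ri: "padded.right_info (Suc k) b (rreg s 3) (rreg s 4)"
    and n13: "nreg s 13 = Suc k" and n17: "nreg s 17 = mark b" and tab: "right_table (Suc k) s"
    using s k by (simp_all add: b_def)
  have "b < 3 * n"
    using ri padded.sources_less unfolding padded.right_info_def by auto
  then have D: "rmem s (k + b + 16 * n) = padded.D (k + b)"
      "rmem s (k + b + 1 + 16 * n) = padded.D (k + b + 1)"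
    using prefix_read[OF d, of "k + b"] prefix_read[OF d, of "k + b + 1"] k by auto
  have M: "nmem s (7 * n + k) = mark k" using mark_read[OF d k(3)] .
  show "backward_inv (Suc i) ?t"
  proof (cases "mark k = 0")
    case True
    have t: "nreg ?t = (nreg s)(13 := k, 15 := 10 * n + k, 16 := 0)" "rreg ?t = rreg s"
      "nmem ?t = (nmem s)(13 * n + k := b)"
      "rmem ?t = (rmem s)(13 * n + k := rreg s 4, 10 * n + k := rreg s 3)"
      using M True k n_pos by (auto simp: backward_body_def r n13 b_def fun_eq_iff)
    have ri': "padded.right_info k b (rreg s 3) (rreg s 4)"
      using padded.right_info_skip[OF ri True] .
    have "prefix_done ?t"
      using d k unfolding prefix_done_def padded_input_def constants_def t by simp
    moreover have "right_table k ?t"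
      unfolding right_table_def
    proof (intro allI impI)
      fix x assume x: "k \<le> x \<and> x < 2 * n \<and> mark x = 0"
      show "padded.right_info x (nmem ?t (13 * n + x)) (rmem ?t (10 * n + x)) (rmem ?t (13 * n + x))"
      proof (cases "x = k")
        case True
        then show ?thesis using ri' n_pos by (simp add: t)
      next
        case False
        with x k have "nmem ?t (13 * n + x) = nmem s (13 * n + x)"
          "rmem ?t (10 * n + x) = rmem s (10 * n + x)" "rmem ?t (13 * n + x) = rmem s (13 * n + x)"
          by (auto simp: t)
        then show ?thesis using x False tab unfolding right_table_def by simp
      qed
    qed
    ultimately show ?thesis
      using ri' n17 unfolding backward_inv_def by (simp add: t k_def[symmetric] b_def)
  next
    case False
    let ?d = "padded.D (border mark k b)"
    have t: "nreg ?t = (nreg s)(13 := k, 15 := 7 * n + k, 16 := mark k, 18 := border mark k b + 16 * n,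
        14 := k, 17 := mark k)"
      "rreg ?t = (rreg s)(11 := ?d, 12 := rreg s 3 - ?d, 4 := max (rreg s 4) (rreg s 3 - ?d), 3 := ?d)"
      "nmem ?t = nmem s" "rmem ?t = rmem s"
      using M False D by (auto simp: backward_body_def r n13 n17 b_def[symmetric] fun_eq_iff border_def sem_set_max)
    have "padded.right_info k k ?d (max (rreg s 4) (rreg s 3 - ?d))"
      using padded.right_info_source[OF ri] False by simp
    moreover have "prefix_done ?t"
      using d unfolding prefix_done_def padded_input_def constants_def t by simp
    moreover have "right_table k ?t"
      using tab False unfolding right_table_def t by (metis Suc_leI le_neq_implies_less)
    ultimately show ?thesis
      unfolding backward_inv_def by (simp add: t k_def[symmetric])
  qed
qed

abbreviation new_load :: "nat \<Rightarrow> real" where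
  "new_load i \<equiv> padded.load_with (p + 3) (n + i)"

text \<open>The best load is initialised with the total weight, which no candidate exceeds.\<close>

definition best_before :: "nat \<Rightarrow> nat \<Rightarrow> real \<Rightarrow> bool" where
  "best_before i v r \<longleftrightarrow>
     (\<forall>j<i. vs ! j \<in> set S) \<and> r = padded.D (6 * n) \<or>
     (\<exists>j<i. vs ! j \<notin> set S \<and> v = vs ! j \<and> r = new_load j \<and>
        (\<forall>j'<i. vs ! j' \<notin> set S \<longrightarrow> r \<le> new_load j'))"

lemma best_before_skip: "best_before i v r \<Longrightarrow> vs ! i \<in> set S \<Longrightarrow> best_before (Suc i) v r"
  unfolding best_before_def less_Suc_eq by blast

text \<open>Being strictly below some load, \<open>r\<close> is below the total weight, hence not
  the initial value but the load of an earlier candidate.\<close>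

lemma best_before_keep:
  assumes "best_before i v r" "r < new_load i"
  shows "best_before (Suc i) v r"
proof -
  have "new_load i \<le> padded.D (6 * n)" using padded.load_with_le_total[of "p + 3" "n + i"] by simp
  with assms(2) have "r < padded.D (6 * n)" by simp
  with assms(1) obtain j where "j < i" "vs ! j \<notin> set S" "v = vs ! j" "r = new_load j"
      "\<forall>j'<i. vs ! j' \<notin> set S \<longrightarrow> r \<le> new_load j'"
    unfolding best_before_def by auto
  with assms(2) show ?thesis unfolding best_before_def less_Suc_eq
    by (intro disjI2 exI[of _ j]) auto
qed

lemma best_before_replace:
  assumes "best_before i v r" "\<not> r < new_load i" "vs ! i \<notin> set S"
  shows "best_before (Suc i) (vs ! i) (new_load i)"
proof -
  have "new_load i \<le> new_load j" if "j < i" "vs ! j \<notin> set S" for j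
    using assms(1,2) that unfolding best_before_def by force
  then show ?thesis using assms(3) unfolding best_before_def less_Suc_eq
    by (intro disjI2 exI[of _ i]) auto
qed

section \<open>Sweep from the left and evaluation of the candidates\<close>

definition forward_inv :: "nat \<Rightarrow> ram \<Rightarrow> bool" where
  "forward_inv i s \<longleftrightarrow> prefix_done s \<and> right_table n s \<and> nreg s 13 = n + i \<and> nreg s 19 = 2 * n \<and>
     nreg s 17 = mark (nreg s 14) \<and> padded.left_info (n + i) (nreg s 14) (rreg s 3) (rreg s 4) \<and>
     best_before i (nreg s 0) (rreg s 5)"

lemma forward_init_triple:
  "triple (backward_inv n) forward_init (code_length forward_init) (forward_inv 0)"
proof (rule triple_loop_free)
  fix s assume "backward_inv n s"
  then have d: "prefix_done s" and tab: "right_table n s" unfolding backward_inv_def by auto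
  note r = prefix_done_regs[OF d]
  let ?t = "sem forward_init s"
  have "nmem s (7 * n + 0) = mark 0" "rmem s (6 * n + 16 * n) = padded.D (6 * n)"
    using mark_read[OF d, of 0] prefix_read[OF d, of "6 * n"] n_pos by auto
  then have t: "nreg ?t = (nreg s)(13 := n, 19 := 2 * n, 14 := 0, 17 := mark 0, 15 := 22 * n)"
    "rreg ?t = (rreg s)(3 := 0, 4 := 0, 5 := padded.D (6 * n))" "nmem ?t = nmem s" "rmem ?t = rmem s"
    by (auto simp: forward_init_def r fun_eq_iff)
  \<comment> \<open>Nothing precedes the left sentinel: its cell starts at 0, where the prefix sum
    is 0.\<close>
  have "padded.left_info n 0 0 0"
    using n_pos by (intro padded.left_info_first) (auto simp: padded_mark_def)
  moreover have "prefix_done ?t"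
    using d unfolding prefix_done_def padded_input_def constants_def t by simp
  ultimately show "forward_inv 0 ?t"
    using tab unfolding forward_inv_def by (simp add: t right_table_def best_before_def)
qed (simp add: forward_init_def)

text \<open>Admits \<open>p + 3\<close> as the mark of the candidate in
  \<open>load_with_eq\<close>.\<close>

lemma mark_less: "mark x < p + 3"
  using priority_le[OF distinct_S, of "vs ! (x - n)"] by (auto simp: padded_mark_def)

lemma sem_evaluate_code:
  assumes d: "prefix_done s" and k: "nreg s 13 = k" "nreg s 14 = a"
    and D: "rmem s (a + k + 1 + 16 * n) = x" "rmem s (k + nmem s (13 * n + k) + 16 * n) = y"
  shows "nmem (sem evaluate_code s) = nmem s" "rmem (sem evaluate_code s) = rmem s"
    "nreg (sem evaluate_code s) = (nreg s)(18 := nmem s (13 * n + k),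
      15 := k + nmem s (13 * n + k) + 16 * n)"
    "rreg (sem evaluate_code s) 11 = max (max (max (max (rreg s 4) (rmem s (13 * n + k)))
      (x - rreg s 3)) (y - x)) (rmem s (10 * n + k) - y)"
    "\<forall>j. j \<notin> {6, 7, 8, 9, 11, 12} \<longrightarrow> rreg (sem evaluate_code s) j = rreg s j"
proof -
  note r = prefix_done_regs[OF d]
  define s1 where "s1 = sem (block [Add 15 8 13, Load 18 15, RLoad 7 15, Add 15 7 13, RLoad 6 15,
    Add 15 14 13, Add 15 15 2, Add 15 15 9, RLoad 8 15, Add 15 13 18, Add 15 15 9, RLoad 9 15,
    RAdd 11 4 0]) s"
  define s2 s3 s4 where "s2 = sem (set_max 11 7) s1" and "s3 = sem (max_difference 8 3) s2"
    and "s4 = sem (max_difference 9 8) s3"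
  let ?t = "sem evaluate_code s"
  have t: "?t = sem (max_difference 6 9) s4"
    by (simp only: evaluate_code_def s1_def s2_def s3_def s4_def sem.simps)
  have s1: "nreg s1 = (nreg s)(18 := nmem s (13 * n + k), 15 := k + nmem s (13 * n + k) + 16 * n)"
    "nmem s1 = nmem s" "rmem s1 = rmem s"
    "rreg s1 = (rreg s)(7 := rmem s (13 * n + k), 6 := rmem s (10 * n + k), 8 := x, 9 := y, 11 := rreg s 4)"
    using D by (simp_all add: s1_def r k fun_eq_iff)
  have z1: "rreg s1 0 = 0" by (simp add: s1 r)
  note s2 = sem_set_max[OF z1, of 11 7, folded s2_def]
  have z2: "rreg s2 0 = 0" by (simp add: s2 z1)
  note s3 = sem_max_difference[OF z2, of 8 3, folded s3_def]
  have z3: "rreg s3 0 = 0" by (simp add: s3 z2)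
  note s4 = sem_max_difference[OF z3, of 9 8, folded s4_def]
  have z4: "rreg s4 0 = 0" by (simp add: s4 z3)
  note s5 = sem_max_difference[OF z4, of 6 9, folded t]
  show "nmem ?t = nmem s" "rmem ?t = rmem s"
    "nreg ?t = (nreg s)(18 := nmem s (13 * n + k), 15 := k + nmem s (13 * n + k) + 16 * n)"
    by (simp_all only: s5 s4 s3 s2 s1)
  show "rreg ?t 11 = max (max (max (max (rreg s 4) (rmem s (13 * n + k)))
      (x - rreg s 3)) (y - x)) (rmem s (10 * n + k) - y)"
    by (simp add: s5(1) s4(1) s3(1) s2(1) s1(4))
  show "\<forall>j. j \<notin> {6, 7, 8, 9, 11, 12} \<longrightarrow> rreg ?t j = rreg s j"
    by (simp add: s5(1) s4(1) s3(1) s2(1) s1(4))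
qed

lemma forward_step:
  assumes "i < n" "forward_inv i s"
  shows "holds (NLess 13 19) s \<and> forward_inv (Suc i) (sem forward_body s)"
proof
  note s = assms(2)[unfolded forward_inv_def]
  then have d: "prefix_done s" by blast
  note r = prefix_done_regs[OF d]
  show "holds (NLess 13 19) s" using assms(1) by (simp add: s r)
  let ?t = "sem forward_body s"
  define k a where "k = n + i" and "a = nreg s 14"
  have k: "k < 2 * n" "k < 3 * n" "n \<le> k" using assms(1) by (auto simp: k_def)
  have li: "padded.left_info k a (rreg s 3) (rreg s 4)" and best: "best_before i (nreg s 0) (rreg s 5)"
    and n13: "nreg s 13 = k" and n17: "nreg s 17 = mark a" and tab: "right_table n s"
    and n19: "nreg s 19 = 2 * n"
    using s by (simp_all add: a_def k_def)
  have a: "a < k" using li unfolding padded.left_info_def by auto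
  then have D: "rmem s (a + k + 16 * n) = padded.D (a + k)"
      "rmem s (a + k + 1 + 16 * n) = padded.D (a + k + 1)"
    using prefix_read[OF d, of "a + k"] prefix_read[OF d, of "a + k + 1"] k by auto
  have M: "nmem s (7 * n + k) = mark k" using mark_read[OF d k(2)] .
  have mk: "mark k = priority S (vs ! i)" using assms(1) by (simp add: k_def)
  show "forward_inv (Suc i) ?t"
  proof (cases "mark k = 0")
    case True
    let ?b = "nmem s (13 * n + k)" and ?v = "rmem s (10 * n + k)"
    have ri: "padded.right_info k ?b ?v (rmem s (13 * n + k))"
      using tab True k unfolding right_table_def by blast
    then have "?b < 3 * n" using padded.sources_less unfolding padded.right_info_def by auto
    then have D': "rmem s (k + ?b + 16 * n) = padded.D (k + ?b)"
      using prefix_read[OF d, of "k + ?b"] k by auto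
    have O: "nmem s (10 * n + k) = vs ! i"
    proof -
      have "nmem s (11 * n + i) = vs ! i"
        using d assms(1) unfolding prefix_done_def padded_input_def by blast
      then show ?thesis by (simp add: k_def)
    qed
    define f where "f = max (max (max (max (rreg s 4) (rmem s (13 * n + k)))
      (padded.D (a + k + 1) - rreg s 3)) (padded.D (k + ?b) - padded.D (a + k + 1))) (?v - padded.D (k + ?b))"
    have f: "new_load i = f"
      using padded.load_with_eq[OF li ri True mark_less] unfolding f_def k_def .
    define s0 where "s0 = sem (block [Add 15 6 13, Load 16 15]) s"
    have s0: "nreg s0 = (nreg s)(15 := 7 * n + k, 16 := 0)" "rreg s0 = rreg s" "nmem s0 = nmem s"
      "rmem s0 = rmem s"
      using M True by (auto simp: s0_def r n13 fun_eq_iff)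
    have d0: "prefix_done s0"
      using d unfolding prefix_done_def padded_input_def constants_def by (simp add: s0)
    define s1 where "s1 = sem evaluate_code s0"
    have k0: "nreg s0 13 = k" "nreg s0 14 = a" by (simp_all add: s0 n13 a_def)
    have D0: "rmem s0 (a + k + 1 + 16 * n) = padded.D (a + k + 1)"
      "rmem s0 (k + nmem s0 (13 * n + k) + 16 * n) = padded.D (k + ?b)"
      unfolding s0 using D(2) D' by blast+
    note ev = sem_evaluate_code[OF d0 k0 D0, folded s1_def, unfolded s0 fun_upd_apply]
    have "\<not> holds (NLess 21 16) s0" by (simp add: s0)
    then have t0: "?t = sem (Basic (Add 13 13 2)) (sem update_code s1)"
      by (simp only: forward_body_def sem.simps(3,4) s0_def[symmetric] s1_def if_False)
    have ev': "rreg s1 11 = f" "rreg s1 5 = rreg s 5" "rreg s1 0 = 0"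
      "nreg s1 2 = 1" "nreg s1 13 = k" "nreg s1 7 = 10 * n" "nreg s1 0 = nreg s 0"
      using ev(4,5) unfolding f_def ev(3) by (simp_all add: r n13)
    have t: "nmem ?t = nmem s" "rmem ?t = rmem s"
      "nreg ?t 0 = (if rreg s 5 < f then nreg s 0 else vs ! i)"
      "rreg ?t 5 = (if rreg s 5 < f then rreg s 5 else f)"
      "nreg ?t 13 = Suc k"
      using O unfolding t0 by (simp_all add: update_code_def ev' ev(1,2))
    have t': "nreg ?t j = nreg s j" if "j \<notin> {0, 13, 15, 16, 18}" for j
      using that unfolding t0 by (simp add: update_code_def ev(3))
    have t'': "rreg ?t j = rreg s j" if "j \<notin> {5, 6, 7, 8, 9, 11, 12}" for j
      using that ev(5) unfolding t0 by (simp add: update_code_def)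
    have "constants ?t"
      using d unfolding prefix_done_def padded_input_def constants_def by (simp add: t' t'')
    then have "prefix_done ?t"
      using d unfolding prefix_done_def padded_input_def by (simp add: t)
    moreover have "right_table n ?t" using tab unfolding right_table_def t(1,2) .
    moreover have "padded.left_info (Suc k) a (rreg s 3) (rreg s 4)"
      using padded.left_info_skip[OF li True] .
    moreover have "best_before (Suc i) (nreg ?t 0) (rreg ?t 5)"
      using best_before_keep[OF best] best_before_replace[OF best] mk True f by (simp add: t)
    moreover have "nreg ?t 14 = a" "nreg ?t 17 = mark a" "nreg ?t 19 = 2 * n"
      "rreg ?t 3 = rreg s 3" "rreg ?t 4 = rreg s 4"
      by (simp_all add: t' t'' n17 n19 a_def)
    ultimately show ?thesis
      unfolding forward_inv_def using t(5) by (simp add: k_def)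
  next
    case False
    let ?d = "padded.D (border mark a k)"
    have t: "nreg ?t = (nreg s)(15 := 7 * n + k, 16 := mark k, 18 := border mark a k + 16 * n,
        14 := k, 17 := mark k, 13 := Suc k)"
      "rreg ?t = (rreg s)(11 := ?d, 12 := ?d - rreg s 3, 4 := max (rreg s 4) (?d - rreg s 3), 3 := ?d)"
      "nmem ?t = nmem s" "rmem ?t = rmem s"
      using M False D by (auto simp: forward_body_def r n13 n17 a_def[symmetric] fun_eq_iff border_def sem_set_max)
    have "padded.left_info (Suc k) k ?d (max (rreg s 4) (?d - rreg s 3))"
      using padded.left_info_source[OF li] False by simp
    moreover have "prefix_done ?t"
      using d unfolding prefix_done_def padded_input_def constants_def t by simp
    moreover have "right_table n ?t" using tab unfolding right_table_def t .
    moreover have "best_before (Suc i) (nreg s 0) (rreg s 5)"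
      using best_before_skip[OF best] mk False by simp
    ultimately show ?thesis
      unfolding forward_inv_def by (simp add: t n19 k_def)
  qed
qed

section \<open>Optimality of the output and total running time\<close>

lemma forward_result:
  assumes "forward_inv n s"
  shows "balanced_vertex {..<n} E \<pi> S (nreg s 0)"
proof -
  have load: "max_load {..<n} E \<pi> (S @ [vs ! j]) = new_load j" if "j < n" "vs ! j \<notin> set S" for j
    using max_load_append[of S \<pi> j] distinct_S cost_nonneg that set_S by blast
  \<comment> \<open>With a vertex left outside \<open>S\<close>, the initial value cannot have
    survived, so register 0 names a candidate.\<close>
  obtain v where "v < n" "v \<notin> set S" using set_S by auto
  then obtain j0 where "j0 < n" "vs ! j0 \<notin> set S" using ex_position by blast
  then have "\<not> (\<forall>j<n. vs ! j \<in> set S)" by blast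
  moreover have "best_before n (nreg s 0) (rreg s 5)" using assms by (simp add: forward_inv_def)
  ultimately obtain j where j: "j < n" "vs ! j \<notin> set S" "nreg s 0 = vs ! j" "rreg s 5 = new_load j"
      "\<forall>i<n. vs ! i \<notin> set S \<longrightarrow> rreg s 5 \<le> new_load i"
    unfolding best_before_def by metis
  have "max_load {..<n} E \<pi> (S @ [vs ! j]) \<le> max_load {..<n} E \<pi> (S @ [u])"
    if u: "u \<in> {..<n} - set S" for u
  proof -
    obtain i where "i < n" "u = vs ! i" using u ex_position[of u] by auto
    then show ?thesis using u j load by simp
  qed
  with j show ?thesis
    unfolding balanced_vertex_def is_arg_min_linorder by simp
qed

lemma code_triple:
  "triple (\<lambda>s. s = input_state n adj \<pi> S) balanced_vertex_code (1000 * (n + 1)) (forward_inv n)"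
proof -
  have a: "triple (mark_inv 0) (While (NLess 13 4) mark_body)
      (p * (code_length mark_body + 2) + 2) (mark_inv p)"
    by (rule triple_While[where I = mark_inv, OF _ mark_step]) (simp_all add: mark_body_def mark_inv_def constants_def)
  have b: "triple (endpoint_inv 0) (While (NLess 2 17) endpoint_body)
      (vs ! 0 * (code_length endpoint_body + 2) + 2) (endpoint_inv (vs ! 0))"
    by (rule triple_While[where I = endpoint_inv, OF _ endpoint_step endpoint_exit]) (simp_all add: endpoint_body_def degree_code_def)
  have c: "triple (traverse_inv 0) (While (NLess 19 20) traverse_body)
      (n * (code_length traverse_body + 2) + 2) (traverse_inv n)"
    by (rule triple_While[where I = traverse_inv, OF _ traverse_step]) (simp_all add: traverse_body_def traverse_inv_def)
  have d: "triple (prefix_inv 0) (While (NLess 13 10) prefix_body)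
      (3 * n * (code_length prefix_body + 2) + 2) (prefix_inv (3 * n))"
    by (rule triple_While[where I = prefix_inv, OF _ prefix_step])
      (simp_all add: prefix_body_def prefix_inv_def padded_input_def constants_def)
  have e: "triple (backward_inv 0) (While (NLess 3 13) backward_body)
      (n * (code_length backward_body + 2) + 2) (backward_inv n)"
    by (rule triple_While[where I = backward_inv, OF _ backward_step])
      (auto simp: backward_body_def set_max_def backward_inv_def prefix_done_regs)
  have f: "triple (forward_inv 0) (While (NLess 13 19) forward_body)
      (n * (code_length forward_body + 2) + 2) (forward_inv n)"
    by (rule triple_While[where I = forward_inv, OF _ forward_step])
      (simp_all add: forward_body_def evaluate_code_def update_code_def max_difference_def
         set_max_def forward_inv_def)
  have "triple (\<lambda>s. s = input_state n adj \<pi> S) balanced_vertex_code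
     (code_length init_code + ((p * (code_length mark_body + 2) + 2) +
      (code_length (Basic (Add 13 21 21) Then degree_code) +
      ((vs ! 0 * (code_length endpoint_body + 2) + 2) +
      (code_length traverse_init + ((n * (code_length traverse_body + 2) + 2) +
      (code_length sentinel_code + ((3 * n * (code_length prefix_body + 2) + 2) +
      (code_length backward_init + ((n * (code_length backward_body + 2) + 2) +
      (code_length forward_init + (n * (code_length forward_body + 2) + 2))))))))))))
     (forward_inv n)" (is "triple _ _ ?t _")
    unfolding balanced_vertex_code_def
    by (intro triple_Seq[OF init_triple] triple_Seq[OF a] triple_Seq[OF endpoint_init_triple]
        triple_Seq[OF b] triple_Seq[OF traverse_init_triple] triple_Seq[OF c]
        triple_Seq[OF sentinel_triple] triple_Seq[OF d] triple_Seq[OF backward_init_triple]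
        triple_Seq[OF e] triple_Seq[OF forward_init_triple] f)
  \<comment> \<open>No loop exceeds \<open>3 * n\<close> rounds, by \<open>p < n\<close> and
    \<open>vs ! 0 < n\<close>; 1000 generously covers the code lengths weighted by the
    rounds.\<close>
  moreover have "?t \<le> 1000 * (n + 1)"
    using p_less less_imp_le[OF vs_less[OF n_pos]]
    by (simp add: init_code_def mark_body_def degree_code_def endpoint_body_def traverse_init_def
        traverse_body_def sentinel_code_def prefix_body_def backward_init_def backward_body_def
        forward_init_def forward_body_def evaluate_code_def update_code_def max_difference_def set_max_def)
  ultimately show ?thesis
    unfolding triple_def by (meson order_trans)
qed

end

theorem lemma3p3:
  "\<exists>(P :: instr list) (T :: nat \<Rightarrow> nat).
     (\<lambda>n. real (T n)) \<in> O(\<lambda>n. real n) \<and>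
     (\<forall>(n :: nat) (E :: nat set set) (adj :: nat list list) (\<pi> :: nat \<Rightarrow> real) (S :: nat list).
        balanced_vertex_instance {..<n} E \<pi> S \<and> is_path {..<n} E \<and> adjacency_lists n E adj \<longrightarrow>
        (\<exists>s. halts_within P (input_state n adj \<pi> S) (T n) s \<and>
             balanced_vertex {..<n} E \<pi> S (output_vertex s)))"
proof (rule exI[of _ "compile 0 balanced_vertex_code"], rule exI[of _ "\<lambda>n. 1000 * (n + 1)"],
    intro conjI allI impI)
  show "(\<lambda>n. real (1000 * (n + 1))) \<in> O(\<lambda>n. real n)"
  \<comment> \<open>\<open>1000 * (n + 1) \<le> 2000 * n\<close> as soon as \<open>n\<close> is
    positive.\<close>
  proof (rule bigoI[of _ 2000])
    show "eventually (\<lambda>n. norm (real (1000 * (n + 1))) \<le> 2000 * norm (real n)) at_top"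
      using eventually_ge_at_top[of 1] by eventually_elim auto
  qed
next
  fix n E adj \<pi> S
  assume "balanced_vertex_instance {..<n} E \<pi> S \<and> is_path {..<n} E \<and> adjacency_lists n E adj"
  then have inst: "balanced_vertex_instance {..<n} E \<pi> S" and path: "is_path {..<n} E"
    and adj: "adjacency_lists n E adj" by blast+
  from path obtain us where us: "us \<noteq> []" "distinct us" "set us = {..<n}"
      "E = {{us ! i, us ! Suc i} | i. Suc i < length us}"
    unfolding is_path_def by blast
  then have "0 < n" by (cases n) auto
  with us have pus: "path_graph n E us" by unfold_locales
  let ?v = "LEAST v. length (adj ! v) < 2"
  \<comment> \<open>The minimum ranges over all natural numbers, although \<open>adj ! v\<close>
    carries no information from \<open>n\<close> on; the bound \<open>us ! 0\<close> shows that it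
    is a vertex.\<close>
  have "length (adj ! ?v) < 2" "?v \<le> us ! 0"
    using path_graph.degree_first[OF pus adj] by (auto intro: LeastI Least_le)
  moreover have "us ! 0 < n" using path_graph.vs_less[OF pus \<open>0 < n\<close>] .
  ultimately obtain i where i: "i < n" "?v = us ! i"
    using path_graph.ex_position[OF pus, of ?v] by auto
  with \<open>length (adj ! ?v) < 2\<close> have "i = 0 \<or> i = n - 1"
    using path_graph.degree_less_2_cases[OF pus adj i(1)] by simp
  \<comment> \<open>The endpoint is the first or the last entry of \<open>us\<close>, so one of the
    two orientations starts with it.\<close>
  then have "us ! 0 = ?v \<or> rev us ! 0 = ?v"
    using i \<open>0 < n\<close> path_graph.length_vs[OF pus] by (auto simp: rev_nth)
  then obtain vs where vs: "path_graph n E vs" "vs ! 0 = ?v"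
    using pus path_graph_rev[OF pus] by blast
  interpret path_graph n E vs by fact
  interpret path_input n E vs adj \<pi> S
    using adj inst vs(2) unfolding balanced_vertex_instance_def proper_list_def
    by unfold_locales auto
  obtain s where s: "forward_inv n s"
      "halts_within (compile 0 balanced_vertex_code) (input_state n adj \<pi> S) (1000 * (n + 1))
         (s\<lparr>pc := code_length balanced_vertex_code\<rparr>)"
    using halts_within_compile[OF code_triple refl] by (auto simp: input_state_def)
  have "output_vertex (s\<lparr>pc := code_length balanced_vertex_code\<rparr>) = nreg s 0"
    by (simp add: output_vertex_def)
  with s forward_result show "\<exists>s. halts_within (compile 0 balanced_vertex_code)
      (input_state n adj \<pi> S) (1000 * (n + 1)) s \<and> balanced_vertex {..<n} E \<pi> S (output_vertex s)"
    by metis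
qed

end
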